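(* Fix positive integers $D,l$, put $q=lD$, and fix pure states $|0\rangle,\dots,|q-1\rangle\in\mathbb{C}^D$ (particle states, as described in the context: $l$ orthonormal bases of $D$ vectors each, all $q$ states pairwise distinct up to phase). Consider the proposed quantum bit-string commitment protocol built from these states and from $q$-ary $(N,n',d)$ error-correcting codes $E$ whose information rate $n'/N=R>0$ and relative minimum distance $d/N=\delta>0$ are kept constant. Then the protocol is binding, that is: for every integer $r>0$ and every real $\varepsilon>0$ there is $n_0$ such that, whenever the code $E$ has these constant ratios $R,\delta$ and the committed string has bit length $n=\lceil n'\log_2 q\rceil\ge n_0$, the inequality $$\sum_{i=1}^{r}\Pr[A_i\,|\,\rho]\le 1+\varepsilon$$ holds for all pairwise distinct strings $A_1,\dots,A_r\in\{0,\dots,q-1\}^{n'}$ and every density matrix $\rho$ on $(\mathbb{C}^D)^{\otimes N}$. Here $\Pr[A\,|\,\rho]$ is the probability that the honest receiver accepts the revealed string $A$ when the $N$ particles sent in the commitment phase are in state $\rho$.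
   Context: Particle states. $D,l$ are positive integers and $q=lD$. The $q$ unit vectors $|0\rangle,\dots,|q-1\rangle\in\mathbb{C}^D$ represent pairwise distinct states (no two agree up to a phase), and they are grouped into $l$ orthonormal bases of $\mathbb{C}^D$: writing $|iD+j\rangle=|i;j\rangle$ for $0\le i\le l-1$, $0\le j\le D-1$, the set $M(i)=\{|i;0\rangle,\dots,|i;D-1\rangle\}$ is an orthonormal basis, $\langle i;j|i;k\rangle=\delta_{jk}$. The collection of bases $M(0),\dots,M(l-1)$ is also assumed to be symmetric under some finite group $G$ acting on $\mathbb{C}^D$ by a representation (each $g\in G$ maps each $M(i)$ to some $M(i')$, up to phases of the vectors); the trivial group is allowed. Code. A $q$-ary $(N,n',d)$ error-correcting code is a map $E:\{0,\dots,q-1\}^{n'}\to\{0,\dots,q-1\}^N$, $A\mapsto E(A)=(e_1,\dots,e_N)$, such that for $A\neq A'$ the codewords $E(A)$ and $E(A')$ differ in at least $d$ positions. Protocol. Commitment phase: the sender chooses $A\in\{0,\dots,q-1\}^{n'}$ and (if honest) sends $N$ particles in state $|e_1\rangle\otimes\cdots\otimes|e_N\rangle$ with $(e_1,\dots,e_N)=E(A)$; the receiver chooses $S=(s_1,\dots,s_N)\in\{0,\dots,l-1\}^N$ uniformly at random and measures the $i$-th particle in the basis $M(s_i)$, recording the result. Open phase: the sender reveals a string $A$; the receiver computes $E(A)=(e_1,\dots,e_N)$ and checks, for each $i$ such that $|e_i\rangle\in M(s_i)$ (meaning that $s_i$ is the index of the basis to which the label $e_i$ belongs, i.e. $s_i=\lfloor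 e_i/D\rfloor$), that his measurement result on particle $i$ was $|e_i\rangle$. He accepts if all these checks succeed and rejects otherwise. The setting is ideal: noiseless channel and error-free detection. Acceptance probability. A (possibly dishonest) sender's transmission is described by an arbitrary density matrix $\rho$ on $(\mathbb{C}^D)^{\otimes N}$. The probability of acceptance of $A$, averaged over $S$ and the measurement outcomes, is $$\Pr[A\,|\,\rho]=\mathrm{Tr}\big(\rho\,P_{E(A)}\big),\qquad P_{(e_1,\dots,e_N)}=\pi(e_1)\otimes\cdots\otimes\pi(e_N),\qquad \pi(e)=\Big(1-\frac1l\Big)\mathbb{I}_D+\frac1l|e\rangle\langle e| ,$$ where $\mathbb{I}_D$ is the identity on $\mathbb{C}^D$. *)

theory Defs
  imports
    Complex_Main
    "HOL-Algebra.Group"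
    "Jordan_Normal_Form.Determinant"
    "Jordan_Normal_Form.Schur_Decomposition"
begin

definition mat_trace :: "complex mat \<Rightarrow> complex" where
  "mat_trace A = (\<Sum>i<dim_row A. A $$ (i, i))"

definition kron :: "complex mat \<Rightarrow> complex mat \<Rightarrow> complex mat" where
  "kron A B = mat (dim_row A * dim_row B) (dim_col A * dim_col B)
     (\<lambda>(i, j). A $$ (i div dim_row B, j div dim_col B) * B $$ (i mod dim_row B, j mod dim_col B))"

definition kron_list :: "complex mat list \<Rightarrow> complex mat" where
  "kron_list As = foldr kron As (1\<^sub>m 1)"

definition proj :: "complex vec \<Rightarrow> complex mat" where
  "proj v = mat (dim_vec v) (dim_vec v) (\<lambda>(i, j). v $ i * cnj (v $ j))"

definition density_operator :: "nat \<Rightarrow> complex mat \<Rightarrow> bool" where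
  "density_operator n \<rho> \<longleftrightarrow>
     \<rho> \<in> carrier_mat n n \<and> mat_adjoint \<rho> = \<rho> \<and>
     (\<forall>v \<in> carrier_vec n. 0 \<le> (\<rho> *\<^sub>v v) \<bullet>c v) \<and> mat_trace \<rho> = 1"

text \<open>The state labelled \<open>i * D + j\<close>, for \<open>i < l\<close> and \<open>j < D\<close>, is the \<open>j\<close>-th vector of
  the \<open>i\<close>-th basis; the values of \<open>\<psi>\<close> at labels \<open>\<ge> l * D\<close> are irrelevant.\<close>

definition particle_states :: "nat \<Rightarrow> nat \<Rightarrow> (nat \<Rightarrow> complex vec) \<Rightarrow> bool" where
  "particle_states D l \<psi> \<longleftrightarrow>
     0 < D \<and> 0 < l \<and>
     (\<forall>a < l * D. \<psi> a \<in> carrier_vec D) \<and>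
     (\<forall>i < l. \<forall>j < D. \<forall>k < D. \<psi> (i * D + j) \<bullet>c \<psi> (i * D + k) = (if j = k then 1 else 0)) \<and>
     (\<forall>a < l * D. \<forall>b < l * D. a \<noteq> b \<longrightarrow> \<not> (\<exists>c. cmod c = 1 \<and> \<psi> a = c \<cdot>\<^sub>v \<psi> b))"

definition symmetric_under ::
  "('g, 'm) monoid_scheme \<Rightarrow> ('g \<Rightarrow> complex mat) \<Rightarrow> nat \<Rightarrow> nat \<Rightarrow> (nat \<Rightarrow> complex vec) \<Rightarrow> bool" where
  "symmetric_under G U D l \<psi> \<longleftrightarrow>
     group G \<and> finite (carrier G) \<and>
     (\<forall>g \<in> carrier G. U g \<in> carrier_mat D D) \<and>
     U \<one>\<^bsub>G\<^esub> = 1\<^sub>m D \<and>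
     (\<forall>g \<in> carrier G. \<forall>h \<in> carrier G. U (g \<otimes>\<^bsub>G\<^esub> h) = U g * U h) \<and>
     (\<forall>g \<in> carrier G. \<forall>i < l. \<exists>i' < l. \<forall>j < D. \<exists>j' < D. \<exists>c. cmod c = 1 \<and>
        U g *\<^sub>v \<psi> (i * D + j) = c \<cdot>\<^sub>v \<psi> (i' * D + j'))"

definition words :: "nat \<Rightarrow> nat \<Rightarrow> nat list set" where
  "words q n = {A. set A \<subseteq> {..<q} \<and> length A = n}"

definition error_correcting_code ::
  "nat \<Rightarrow> nat \<Rightarrow> nat \<Rightarrow> nat \<Rightarrow> (nat list \<Rightarrow> nat list) \<Rightarrow> bool" where
  "error_correcting_code q N n' d E \<longleftrightarrow>
     (\<forall>A \<in> words q n'. E A \<in> words q N) \<and>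
     (\<forall>A \<in> words q n'. \<forall>A' \<in> words q n'. A \<noteq> A' \<longrightarrow> d \<le> card {i. i < N \<and> E A ! i \<noteq> E A' ! i})"

definition bit_length :: "nat \<Rightarrow> nat \<Rightarrow> int" where
  "bit_length q n' = \<lceil>real n' * log 2 (real q)\<rceil>"

text \<open>Born rule for measuring particle \<open>i\<close> in basis \<open>S ! i\<close> with outcome index \<open>m ! i\<close> within
  that basis. The trace is real for density operators.\<close>

definition outcome_prob ::
  "nat \<Rightarrow> (nat \<Rightarrow> complex vec) \<Rightarrow> complex mat \<Rightarrow> nat list \<Rightarrow> nat list \<Rightarrow> real" where
  "outcome_prob D \<psi> \<rho> S m =
     Re (mat_trace (\<rho> * kron_list (map2 (\<lambda>s j. proj (\<psi> (s * D + j))) S m)))"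

definition accepts :: "nat \<Rightarrow> nat list \<Rightarrow> nat list \<Rightarrow> nat list \<Rightarrow> bool" where
  "accepts D e S m \<longleftrightarrow> (\<forall>i < length e. e ! i div D = S ! i \<longrightarrow> S ! i * D + m ! i = e ! i)"

definition accept_prob ::
  "nat \<Rightarrow> nat \<Rightarrow> (nat \<Rightarrow> complex vec) \<Rightarrow> complex mat \<Rightarrow> nat list \<Rightarrow> real" where
  "accept_prob D l \<psi> \<rho> e =
     (\<Sum>S \<in> words l (length e). \<Sum>m \<in> words D (length e).
        if accepts D e S m then outcome_prob D \<psi> \<rho> S m else 0) / real l ^ length e"

text \<open>Averaging over the bases turns the acceptance test into a product operator;
  see \<open>accept_prob_eq_trace\<close> below.\<close>

definition check_op :: "nat \<Rightarrow> nat \<Rightarrow> (nat \<Rightarrow> complex vec) \<Rightarrow> nat \<Rightarrow> complex mat" where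
  "check_op D l \<psi> e =
     complex_of_real (1 - 1 / real l) \<cdot>\<^sub>m 1\<^sub>m D + complex_of_real (1 / real l) \<cdot>\<^sub>m proj (\<psi> e)"

definition accept_op :: "nat \<Rightarrow> nat \<Rightarrow> (nat \<Rightarrow> complex vec) \<Rightarrow> nat list \<Rightarrow> complex mat" where
  "accept_op D l \<psi> e = kron_list (map (check_op D l \<psi>) e)"

lemma kron_list_Cons: "kron_list (A # As) = kron A (kron_list As)"
  by (simp add: kron_list_def)

lemma kron_list_carrier:
  assumes "\<And>A. A \<in> set As \<Longrightarrow> A \<in> carrier_mat D D"
  shows "kron_list As \<in> carrier_mat (D ^ length As) (D ^ length As)"
  using assms
proof (induction As)
  case Nil
  then show ?case by (simp add: kron_list_def)
next
  case (Cons A As)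
  then have "A \<in> carrier_mat D D" "kron_list As \<in> carrier_mat (D ^ length As) (D ^ length As)"
    by auto
  then show ?case by (auto simp: kron_list_Cons kron_def)
qed

lemma kron_list_Cons_index:
  assumes "A \<in> carrier_mat D D" "\<And>B. B \<in> set As \<Longrightarrow> B \<in> carrier_mat D D"
    and "a < D ^ Suc (length As)" "b < D ^ Suc (length As)"
  shows "kron_list (A # As) $$ (a, b) =
    A $$ (a div D ^ length As, b div D ^ length As) *
    kron_list As $$ (a mod D ^ length As, b mod D ^ length As)"
  using assms kron_list_carrier[of As D] by (auto simp: kron_list_Cons kron_def)

lemma finite_words [simp]: "finite (words q n)"
  unfolding words_def by (rule finite_lists_length_eq) simp

lemma sum_words_Suc: "(\<Sum>w \<in> words q (Suc n). f w) = (\<Sum>a<q. \<Sum>w \<in> words q n. f (a # w))"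
proof -
  have "words q (Suc n) = (\<lambda>(a, w). a # w) ` ({..<q} \<times> words q n)"
  proof (intro equalityI subsetI)
    fix w assume "w \<in> words q (Suc n)"
    then show "w \<in> (\<lambda>(a, w). a # w) ` ({..<q} \<times> words q n)"
      unfolding words_def by (cases w) auto
  qed (auto simp: words_def)
  moreover have "inj_on (\<lambda>(a, w). a # w) ({..<q} \<times> words q n)"
    by (auto simp: inj_on_def)
  ultimately have "sum f (words q (Suc n)) = (\<Sum>(a, w) \<in> {..<q} \<times> words q n. f (a # w))"
    by (simp add: sum.reindex comp_def case_prod_unfold)
  then show ?thesis by (simp add: sum.cartesian_product)
qed

lemma label_less: "i < l \<Longrightarrow> j < D \<Longrightarrow> i * D + j < l * (D :: nat)"
proof -
  assume "i < l" "j < D"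
  then have "i * D + j < Suc i * D" "Suc i * D \<le> l * D" by (simp, intro mult_le_mono1, simp)
  then show ?thesis by linarith
qed

lemma proj_carrier: "v \<in> carrier_vec D \<Longrightarrow> proj v \<in> carrier_mat D D"
  by (auto simp: proj_def)

lemma measurement_carrier:
  assumes "particle_states D l \<psi>" "S \<in> words l n" "m \<in> words D n"
    and "B \<in> set (map2 (\<lambda>s j. proj (\<psi> (s * D + j))) S m)"
  shows "B \<in> carrier_mat D D"
proof -
  from assms(4) obtain s j where sj: "(s, j) \<in> set (zip S m)" and B: "B = proj (\<psi> (s * D + j))"
    by auto
  then have "s < l" "j < D"
    using assms(2,3) set_zip_leftD[OF sj] set_zip_rightD[OF sj] by (auto simp: words_def)
  then show ?thesis
    using assms(1) label_less[of s l j D] B by (auto simp: particle_states_def intro!: proj_carrier)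
qed

lemma basis_complete:
  assumes "particle_states D l \<psi>" "i < l" "a < D" "b < D"
  shows "(\<Sum>j<D. proj (\<psi> (i * D + j)) $$ (a, b)) = (if a = b then 1 else 0)"
proof -
  define V where "V = mat D D (\<lambda>(a, j). \<psi> (i * D + j) $ a)"
  define W where "W = mat D D (\<lambda>(j, a). cnj (\<psi> (i * D + j) $ a))"
  have dim: "dim_vec (\<psi> (i * D + j)) = D" if "j < D" for j
    using assms(1,2) label_less[of i l j D] that by (auto simp: particle_states_def)
  have orth: "\<psi> (i * D + j) \<bullet>c \<psi> (i * D + k) = (if j = k then 1 else 0)" if "j < D" "k < D" for j k
    using assms(1,2) that by (auto simp: particle_states_def)
  have "W * V = 1\<^sub>m D"
  proof (rule eq_matI)
    fix j k assume jk: "j < dim_row (1\<^sub>m D :: complex mat)" "k < dim_col (1\<^sub>m D :: complex mat)"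
    then have "(W * V) $$ (j, k) = \<psi> (i * D + k) \<bullet>c \<psi> (i * D + j)"
      using dim by (auto simp: W_def V_def scalar_prod_def intro!: sum.cong)
    then show "(W * V) $$ (j, k) = (1\<^sub>m D :: complex mat) $$ (j, k)"
      using orth[of k j] jk by auto
  qed (auto simp: W_def V_def)
  then have "V * W = 1\<^sub>m D"
    by (rule mat_mult_left_right_inverse[of W D V, rotated 2]) (auto simp: W_def V_def)
  then have "(V * W) $$ (a, b) = (1\<^sub>m D :: complex mat) $$ (a, b)" by simp
  then have "(\<Sum>j<D. \<psi> (i * D + j) $ a * cnj (\<psi> (i * D + j) $ b)) = (if a = b then 1 else 0)"
    using assms(3,4) by (simp add: V_def W_def scalar_prod_def atLeast0LessThan)
  moreover have "(\<Sum>j<D. proj (\<psi> (i * D + j)) $$ (a, b))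
      = (\<Sum>j<D. \<psi> (i * D + j) $ a * cnj (\<psi> (i * D + j) $ b))"
    using dim assms(3,4) by (intro sum.cong) (auto simp: proj_def)
  ultimately show ?thesis by simp
qed

lemma check_op_carrier:
  "particle_states D l \<psi> \<Longrightarrow> e < l * D \<Longrightarrow> check_op D l \<psi> e \<in> carrier_mat D D"
  unfolding check_op_def
  by (intro add_carrier_mat smult_carrier_mat proj_carrier) (simp add: particle_states_def)

lemma check_op_index:
  assumes "particle_states D l \<psi>" "e < l * D" "a < D" "b < D"
  shows "(\<Sum>s<l. \<Sum>j<D. if e div D = s \<longrightarrow> s * D + j = e
           then proj (\<psi> (s * D + j)) $$ (a, b) else 0)
       = of_nat l * check_op D l \<psi> e $$ (a, b)"
proof -
  have pos: "0 < D" "0 < l" and carr: "\<psi> e \<in> carrier_vec D"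
    using assms(1,2) by (auto simp: particle_states_def)
  have ediv: "e div D < l" using assms(2) pos by (simp add: less_mult_imp_div_less)
  have inner: "(\<Sum>j<D. if e div D = s \<longrightarrow> s * D + j = e then proj (\<psi> (s * D + j)) $$ (a, b) else 0)
      = (if s = e div D then proj (\<psi> e) $$ (a, b) else if a = b then 1 else 0)" if "s < l" for s
  proof (cases "s = e div D")
    case True
    have "s * D + j = e \<longleftrightarrow> j = e mod D" for j
      unfolding True by (metis add_left_cancel div_mult_mod_eq)
    then have "(\<Sum>j<D. if e div D = s \<longrightarrow> s * D + j = e then proj (\<psi> (s * D + j)) $$ (a, b) else 0)
        = (\<Sum>j<D. if j = e mod D then proj (\<psi> (s * D + j)) $$ (a, b) else 0)"
      using True by simp
    also have "\<dots> = proj (\<psi> e) $$ (a, b)"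
      using True pos by (simp add: sum.delta)
    finally show ?thesis using True by simp
  next
    case False
    then show ?thesis using basis_complete[OF assms(1) that assms(3,4)] by auto
  qed
  have "(\<Sum>s<l. \<Sum>j<D. if e div D = s \<longrightarrow> s * D + j = e then proj (\<psi> (s * D + j)) $$ (a, b) else 0)
      = (\<Sum>s<l. if s = e div D then proj (\<psi> e) $$ (a, b) else if a = b then 1 else 0)"
    by (intro sum.cong refl inner) simp
  also have "\<dots> = proj (\<psi> e) $$ (a, b) + (\<Sum>s \<in> {..<l} - {e div D}. if a = b then 1 else 0)"
    using ediv by (subst sum.remove[of _ "e div D"]) (auto intro!: sum.cong)
  also have "\<dots> = proj (\<psi> e) $$ (a, b) + (of_nat l - 1) * (if a = b then 1 else 0)"
    using ediv pos by (simp add: of_nat_diff)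
  also have "\<dots> = of_nat l * check_op D l \<psi> e $$ (a, b)"
    using assms(3,4) pos carr proj_carrier[OF carr] by (auto simp: check_op_def field_simps)
  finally show ?thesis .
qed

lemma accepts_Cons:
  "accepts D (x # e) (s # S) (j # m) \<longleftrightarrow> (x div D = s \<longrightarrow> s * D + j = x) \<and> accepts D e S m"
  unfolding accepts_def by (auto simp: less_Suc_eq_0_disj)

lemma accept_op_index:
  assumes "particle_states D l \<psi>" "e \<in> words (l * D) n" "a < D ^ n" "b < D ^ n"
  shows "(\<Sum>S \<in> words l n. \<Sum>m \<in> words D n. if accepts D e S m
           then kron_list (map2 (\<lambda>s j. proj (\<psi> (s * D + j))) S m) $$ (a, b) else 0)
       = of_nat l ^ n * accept_op D l \<psi> e $$ (a, b)"
  using assms(2-4)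
proof (induction n arbitrary: e a b)
  case 0
  moreover have "words k 0 = {[]}" for k by (auto simp: words_def)
  ultimately show ?case by (simp add: accepts_def accept_op_def)
next
  case (Suc n)
  let ?P = "\<lambda>s j. proj (\<psi> (s * D + j))"
  from Suc.prems(1) obtain x e' where e: "e = x # e'" and x: "x < l * D" and e': "e' \<in> words (l * D) n"
    by (cases e) (auto simp: words_def)
  have pos: "0 < D" using assms(1) by (simp add: particle_states_def)
  have len: "length e' = n" and set_e': "\<And>y. y \<in> set e' \<Longrightarrow> y < l * D"
    using e' by (auto simp: words_def)
  have hi: "a div D ^ n < D" "b div D ^ n < D"
    using Suc.prems by (auto simp: less_mult_imp_div_less)
  have lo: "a mod D ^ n < D ^ n" "b mod D ^ n < D ^ n" using pos by auto
  have P: "?P s j \<in> carrier_mat D D" if "s < l" "j < D" for s j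
    using assms(1) that label_less[of s l j D] by (auto simp: particle_states_def intro!: proj_carrier)
  have split: "kron_list (?P s j # map2 ?P S m) $$ (a, b)
      = ?P s j $$ (a div D ^ n, b div D ^ n) * kron_list (map2 ?P S m) $$ (a mod D ^ n, b mod D ^ n)"
    if "s < l" "j < D" "S \<in> words l n" "m \<in> words D n" for s j S m
  proof -
    have "B \<in> carrier_mat D D" if "B \<in> set (map2 ?P S m)" for B
      using measurement_carrier[OF assms(1) \<open>S \<in> words l n\<close> \<open>m \<in> words D n\<close> that] .
    moreover have "length (map2 ?P S m) = n" using that by (simp add: words_def)
    ultimately show ?thesis
      using kron_list_Cons_index[of "?P s j" D "map2 ?P S m" a b] P[OF that(1,2)] Suc.prems(2,3)
      by simp
  qed
  have "(\<Sum>S \<in> words l (Suc n). \<Sum>m \<in> words D (Suc n). if accepts D e S m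
           then kron_list (map2 ?P S m) $$ (a, b) else 0)
      = (\<Sum>s<l. \<Sum>S \<in> words l n. \<Sum>j<D. \<Sum>m \<in> words D n.
           (if x div D = s \<longrightarrow> s * D + j = x then ?P s j $$ (a div D ^ n, b div D ^ n) else 0) *
           (if accepts D e' S m then kron_list (map2 ?P S m) $$ (a mod D ^ n, b mod D ^ n) else 0))"
    unfolding sum_words_Suc
    by (intro sum.cong refl) (simp add: e accepts_Cons split)
  also have "\<dots> = (\<Sum>s<l. \<Sum>j<D. if x div D = s \<longrightarrow> s * D + j = x
           then ?P s j $$ (a div D ^ n, b div D ^ n) else 0) *
        (\<Sum>S \<in> words l n. \<Sum>m \<in> words D n. if accepts D e' S m
           then kron_list (map2 ?P S m) $$ (a mod D ^ n, b mod D ^ n) else 0)"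
    by (simp only: sum_product)
  also have "\<dots> = of_nat l ^ Suc n *
      (check_op D l \<psi> x $$ (a div D ^ n, b div D ^ n) * accept_op D l \<psi> e' $$ (a mod D ^ n, b mod D ^ n))"
    unfolding check_op_index[OF assms(1) x hi] Suc.IH[OF e' lo] by (simp add: algebra_simps)
  also have "check_op D l \<psi> x $$ (a div D ^ n, b div D ^ n) * accept_op D l \<psi> e' $$ (a mod D ^ n, b mod D ^ n)
      = accept_op D l \<psi> e $$ (a, b)"
  proof -
    have "B \<in> carrier_mat D D" if "B \<in> set (map (check_op D l \<psi>) e')" for B
      using that check_op_carrier[OF assms(1)] set_e' by auto
    then show ?thesis
      using kron_list_Cons_index[of "check_op D l \<psi> x" D "map (check_op D l \<psi>) e'" a b]
        check_op_carrier[OF assms(1) x] Suc.prems(2,3) len by (simp add: accept_op_def e)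
  qed
  finally show ?case .
qed

lemma mat_trace_mult:
  assumes "A \<in> carrier_mat n n" "B \<in> carrier_mat n n"
  shows "mat_trace (A * B) = (\<Sum>a<n. \<Sum>b<n. A $$ (a, b) * B $$ (b, a))"
  using assms by (auto simp: mat_trace_def scalar_prod_def atLeast0LessThan intro!: sum.cong)

lemma accept_prob_eq_trace:
  assumes "particle_states D l \<psi>" "e \<in> words (l * D) N" "\<rho> \<in> carrier_mat (D ^ N) (D ^ N)"
  shows "accept_prob D l \<psi> \<rho> e = Re (mat_trace (\<rho> * accept_op D l \<psi> e))"
proof -
  let ?K = "\<lambda>S m. kron_list (map2 (\<lambda>s j. proj (\<psi> (s * D + j))) S m)"
  have len: "length e = N" and l: "0 < l"
    using assms by (auto simp: words_def particle_states_def)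
  have K: "?K S m \<in> carrier_mat (D ^ N) (D ^ N)" if "S \<in> words l N" "m \<in> words D N" for S m
  proof -
    have "length (map2 (\<lambda>s j. proj (\<psi> (s * D + j))) S m) = N"
      using that by (simp add: words_def)
    with kron_list_carrier[OF measurement_carrier[OF assms(1) that]] show ?thesis by metis
  qed
  have Q: "accept_op D l \<psi> e \<in> carrier_mat (D ^ N) (D ^ N)"
    using kron_list_carrier[of "map (check_op D l \<psi>) e" D] check_op_carrier[OF assms(1)] assms(2)
    by (auto simp: accept_op_def words_def)
  have "(\<Sum>S \<in> words l N. \<Sum>m \<in> words D N. if accepts D e S m then mat_trace (\<rho> * ?K S m) else 0)
      = (\<Sum>S \<in> words l N. \<Sum>m \<in> words D N. \<Sum>a<D^N. \<Sum>b<D^N.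
           \<rho> $$ (a, b) * (if accepts D e S m then ?K S m $$ (b, a) else 0))"
    by (intro sum.cong refl) (simp add: mat_trace_mult[OF assms(3) K])
  also have "\<dots> = (\<Sum>S \<in> words l N. \<Sum>a<D^N. \<Sum>m \<in> words D N. \<Sum>b<D^N.
           \<rho> $$ (a, b) * (if accepts D e S m then ?K S m $$ (b, a) else 0))"
    by (intro sum.cong refl sum.swap)
  also have "\<dots> = (\<Sum>a<D^N. \<Sum>S \<in> words l N. \<Sum>m \<in> words D N. \<Sum>b<D^N.
           \<rho> $$ (a, b) * (if accepts D e S m then ?K S m $$ (b, a) else 0))"
    by (rule sum.swap)
  also have "\<dots> = (\<Sum>a<D^N. \<Sum>S \<in> words l N. \<Sum>b<D^N. \<Sum>m \<in> words D N.
           \<rho> $$ (a, b) * (if accepts D e S m then ?K S m $$ (b, a) else 0))"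
    by (intro sum.cong refl sum.swap)
  also have "\<dots> = (\<Sum>a<D^N. \<Sum>b<D^N. \<Sum>S \<in> words l N. \<Sum>m \<in> words D N.
           \<rho> $$ (a, b) * (if accepts D e S m then ?K S m $$ (b, a) else 0))"
    by (intro sum.cong refl sum.swap)
  also have "\<dots> = (\<Sum>a<D^N. \<Sum>b<D^N. \<rho> $$ (a, b) * (of_nat l ^ N * accept_op D l \<psi> e $$ (b, a)))"
    by (intro sum.cong refl)
      (simp only: sum_distrib_left[symmetric] accept_op_index[OF assms(1,2)] lessThan_iff)
  also have "\<dots> = of_real (real l ^ N) * mat_trace (\<rho> * accept_op D l \<psi> e)"
    by (simp add: mat_trace_mult[OF assms(3) Q] sum_distrib_left algebra_simps)
  finally have main: "(\<Sum>S \<in> words l N. \<Sum>m \<in> words D N.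
       if accepts D e S m then mat_trace (\<rho> * ?K S m) else 0)
      = of_real (real l ^ N) * mat_trace (\<rho> * accept_op D l \<psi> e)" .
  have "(\<Sum>S \<in> words l N. \<Sum>m \<in> words D N. if accepts D e S m then outcome_prob D \<psi> \<rho> S m else 0)
      = Re (\<Sum>S \<in> words l N. \<Sum>m \<in> words D N. if accepts D e S m then mat_trace (\<rho> * ?K S m) else 0)"
    unfolding Re_sum by (intro sum.cong refl) (simp add: outcome_prob_def)
  also have "\<dots> = real l ^ N * Re (mat_trace (\<rho> * accept_op D l \<psi> e))"
    unfolding main by simp
  finally show ?thesis unfolding accept_prob_def len using l by simp
qed

end

theory Submission
  imports Defs "HOL-Analysis.L2_Norm"
begin

text \<open>
  The acceptance operator \<open>P\<^sub>A\<close> of a string is the square of a Hermitian product operator \<open>K\<^sub>A\<close>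
  whose factors are \<open>\<kappa>(e) = a I + (1 - a) |e><e|\<close> with \<open>a\<^sup>2 = 1 - 1/l\<close>. Since distinct states are
  not parallel, \<open>\<parallel>\<kappa>(e) \<kappa>(e')\<parallel> \<le> 1 - (1 - a)\<^sup>2 (1 - |<e|e'>|) < 1\<close>, so for distinct strings
  \<open>\<parallel>K\<^sub>A K\<^sub>B\<parallel> \<le> c\<^sup>d\<close> with some fixed \<open>c < 1\<close>. For a vector \<open>w\<close> put \<open>u\<^sub>i = K\<^sub>i w\<close> and
  \<open>x = \<Sum> \<parallel>u\<^sub>i\<parallel>\<^sup>2 = <w, \<Sum> K\<^sub>i u\<^sub>i>\<close>. The Cauchy--Schwarz inequality gives
  \<open>x\<^sup>2 \<le> \<parallel>w\<parallel>\<^sup>2 (x + r\<^sup>2 c\<^sup>d \<parallel>w\<parallel>\<^sup>2)\<close>, whence \<open>x \<le> (1 + r\<^sup>2 c\<^sup>d) \<parallel>w\<parallel>\<^sup>2\<close>. A density operator is a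
  sum of rank-one terms \<open>w w\<^sup>*\<close> with total weight one, which extends the bound to mixed states.
\<close>

section \<open>Vectors and operator bounds\<close>

text \<open>Vectors are plain functions of which only the values below \<open>n\<close> matter, so
  no carrier conditions arise and the inequalities for \<open>L2_set\<close> apply directly.\<close>

definition vnorm :: "nat \<Rightarrow> (nat \<Rightarrow> complex) \<Rightarrow> real" where
  "vnorm n v = L2_set (\<lambda>i. cmod (v i)) {..<n}"

text \<open>Conjugation falls on the first argument, whereas \<open>\<bullet>c\<close> conjugates
  the second.\<close>

definition sprod :: "nat \<Rightarrow> (nat \<Rightarrow> complex) \<Rightarrow> (nat \<Rightarrow> complex) \<Rightarrow> complex" where
  "sprod n u v = (\<Sum>i<n. cnj (u i) * v i)"

definition mapply :: "nat \<Rightarrow> complex mat \<Rightarrow> (nat \<Rightarrow> complex) \<Rightarrow> nat \<Rightarrow> complex" where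
  "mapply n A v i = (\<Sum>j<n. A $$ (i, j) * v j)"

text \<open>An upper bound for the operator norm. The sign condition is explicit because for
  \<open>n = 0\<close> the inequality alone admits every real \<open>c\<close>, while products of
  bounds call for nonnegative factors.\<close>

definition op_bound :: "nat \<Rightarrow> complex mat \<Rightarrow> real \<Rightarrow> bool" where
  "op_bound n A c \<longleftrightarrow> 0 \<le> c \<and> (\<forall>v. vnorm n (mapply n A v) \<le> c * vnorm n v)"

lemma vnorm_nonneg [simp]: "0 \<le> vnorm n v"
  by (simp add: vnorm_def)

lemma vnorm_sq: "(vnorm n v)\<^sup>2 = (\<Sum>i<n. (cmod (v i))\<^sup>2)"
  by (simp add: vnorm_def L2_set_def sum_nonneg)

lemma vnorm_cong: "(\<And>i. i < n \<Longrightarrow> u i = v i) \<Longrightarrow> vnorm n u = vnorm n v"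
  unfolding vnorm_def by (intro L2_set_cong) simp_all

lemma vnorm_triangle: "vnorm n (\<lambda>i. u i + v i) \<le> vnorm n u + vnorm n v"
proof -
  have "vnorm n (\<lambda>i. u i + v i) \<le> L2_set (\<lambda>i. cmod (u i) + cmod (v i)) {..<n}"
    unfolding vnorm_def by (intro L2_set_mono norm_triangle_ineq) auto
  also have "\<dots> \<le> vnorm n u + vnorm n v"
    unfolding vnorm_def by (rule L2_set_triangle_ineq)
  finally show ?thesis .
qed

lemma vnorm_scale: "vnorm n (\<lambda>i. c * v i) = cmod c * vnorm n v"
  by (simp add: vnorm_def norm_mult L2_set_right_distrib)

lemma sprod_self: "sprod n v v = of_real ((vnorm n v)\<^sup>2)"
  by (simp add: sprod_def vnorm_sq complex_mult_cnj cmod_power2 mult.commute[of "cnj _"])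

lemma sprod_bound: "cmod (sprod n u v) \<le> vnorm n u * vnorm n v"
proof -
  have "cmod (sprod n u v) \<le> (\<Sum>i<n. \<bar>cmod (u i)\<bar> * \<bar>cmod (v i)\<bar>)"
    unfolding sprod_def by (rule order_trans[OF norm_sum]) (simp add: norm_mult)
  also have "\<dots> \<le> vnorm n u * vnorm n v"
    unfolding vnorm_def by (rule L2_set_mult_ineq)
  finally show ?thesis .
qed

lemma sprod_sum_right: "sprod n u (\<lambda>a. \<Sum>i\<in>I. v i a) = (\<Sum>i\<in>I. sprod n u (v i))"
  unfolding sprod_def by (simp add: sum_distrib_left) (rule sum.swap)

lemma sprod_sum_left: "sprod n (\<lambda>a. \<Sum>i\<in>I. u i a) v = (\<Sum>i\<in>I. sprod n (u i) v)"
  unfolding sprod_def by (simp add: sum_distrib_right) (rule sum.swap)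

lemma mapply_mult:
  assumes "A \<in> carrier_mat n n" "B \<in> carrier_mat n n" "i < n"
  shows "mapply n (A * B) v i = mapply n A (mapply n B v) i"
proof -
  have "mapply n (A * B) v i = (\<Sum>j<n. \<Sum>k<n. A $$ (i, k) * B $$ (k, j) * v j)"
    using assms by (simp add: mapply_def scalar_prod_def atLeast0LessThan sum_distrib_right)
  also have "\<dots> = (\<Sum>k<n. \<Sum>j<n. A $$ (i, k) * B $$ (k, j) * v j)"
    by (rule sum.swap)
  also have "\<dots> = mapply n A (mapply n B v) i"
    by (simp add: mapply_def sum_distrib_left mult.assoc)
  finally show ?thesis .
qed

lemma sprod_mapply_hermitian:
  assumes "\<And>i j. i < n \<Longrightarrow> j < n \<Longrightarrow> A $$ (i, j) = cnj (A $$ (j, i))"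
  shows "sprod n u (mapply n A v) = sprod n (mapply n A u) v"
proof -
  have "sprod n u (mapply n A v) = (\<Sum>i<n. \<Sum>j<n. cnj (u i) * (A $$ (i, j) * v j))"
    by (simp add: sprod_def mapply_def sum_distrib_left)
  also have "\<dots> = (\<Sum>j<n. \<Sum>i<n. cnj (u i) * (A $$ (i, j) * v j))"
    by (rule sum.swap)
  also have "\<dots> = (\<Sum>j<n. \<Sum>i<n. cnj (A $$ (j, i)) * cnj (u i) * v j)"
    by (intro sum.cong refl) (subst assms, auto)
  also have "\<dots> = sprod n (mapply n A u) v"
    by (simp add: sprod_def mapply_def sum_distrib_right)
  finally show ?thesis .
qed

lemma op_boundD: "op_bound n A c \<Longrightarrow> vnorm n (mapply n A v) \<le> c * vnorm n v"
  by (simp add: op_bound_def)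

lemma op_bound_nonneg: "op_bound n A c \<Longrightarrow> 0 \<le> c"
  by (simp add: op_bound_def)

lemma op_bound_mono: "op_bound n A c \<Longrightarrow> c \<le> c' \<Longrightarrow> op_bound n A c'"
  unfolding op_bound_def by (meson order_trans mult_right_mono vnorm_nonneg)

lemma op_bound_mult:
  assumes "A \<in> carrier_mat n n" "B \<in> carrier_mat n n" "op_bound n A c" "op_bound n B d"
  shows "op_bound n (A * B) (c * d)"
  unfolding op_bound_def
proof (intro conjI allI)
  show "0 \<le> c * d" using assms by (simp add: op_bound_def)
  fix v
  have "vnorm n (mapply n (A * B) v) = vnorm n (mapply n A (mapply n B v))"
    by (rule vnorm_cong) (rule mapply_mult[OF assms(1,2)])
  also have "\<dots> \<le> c * vnorm n (mapply n B v)" by (rule op_boundD[OF assms(3)])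
  also have "\<dots> \<le> c * (d * vnorm n v)"
    by (intro mult_left_mono op_boundD assms(4) op_bound_nonneg[OF assms(3)])
  finally show "vnorm n (mapply n (A * B) v) \<le> c * d * vnorm n v" by (simp add: mult.assoc)
qed

section \<open>Kronecker products\<close>

lemma sum_lessThan_mult:
  fixes f :: "nat \<Rightarrow> 'a::comm_monoid_add"
  shows "(\<Sum>k<m * n. f k) = (\<Sum>i<m. \<Sum>j<n. f (i * n + j))"
proof -
  have "(\<Sum>i<m. \<Sum>j<n. f (i * n + j)) = (\<Sum>i<m. sum f {i * n..<i * n + n})"
    by (rule sum.cong[OF refl], subst sum.atLeastLessThan_shift_0) (simp add: atLeast0LessThan)
  then show ?thesis by (simp add: sum.nat_group)
qed

lemma kron_carrier:
  "A \<in> carrier_mat m m \<Longrightarrow> B \<in> carrier_mat n n \<Longrightarrow> kron A B \<in> carrier_mat (m * n) (m * n)"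
  by (auto simp: kron_def)

lemma kron_index:
  assumes "A \<in> carrier_mat m m" "B \<in> carrier_mat n n" "i < m" "i' < n" "j < m" "j' < n"
  shows "kron A B $$ (i * n + i', j * n + j') = A $$ (i, j) * B $$ (i', j')"
  using assms label_less[of i m i' n] label_less[of j m j' n] by (auto simp: kron_def)

text \<open>Read \<open>v\<close> as an \<open>m\<close> by \<open>n\<close> array. The product
  first applies \<open>B\<close> to each row, giving \<open>y\<close>, and then \<open>A\<close> to
  each column of \<open>y\<close>. Summing the squared bounds over columns and then over rows yields
  the product of the two bounds.\<close>

lemma op_bound_kron:
  assumes A: "A \<in> carrier_mat m m" and B: "B \<in> carrier_mat n n"
    and "op_bound m A c" "op_bound n B d"
  shows "op_bound (m * n) (kron A B) (c * d)"
  unfolding op_bound_def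
proof (intro conjI allI)
  have c: "0 \<le> c" and d: "0 \<le> d" using assms(3,4) by (simp_all add: op_bound_def)
  then show cd: "0 \<le> c * d" by simp
  fix v
  define y where "y j i' = mapply n B (\<lambda>j'. v (j * n + j')) i'" for j i'
  have entry: "mapply (m * n) (kron A B) v (i * n + i') = mapply m A (\<lambda>j. y j i') i"
    if "i < m" "i' < n" for i i'
    using that
    by (simp add: mapply_def sum_lessThan_mult kron_index[OF A B] y_def sum_distrib_left mult.assoc)
  have "(vnorm (m * n) (mapply (m * n) (kron A B) v))\<^sup>2
      = (\<Sum>i<m. \<Sum>i'<n. (cmod (mapply m A (\<lambda>j. y j i') i))\<^sup>2)"
    by (simp add: vnorm_sq sum_lessThan_mult entry)
  also have "\<dots> = (\<Sum>i'<n. (vnorm m (mapply m A (\<lambda>j. y j i')))\<^sup>2)"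
    by (simp add: vnorm_sq) (rule sum.swap)
  also have "\<dots> \<le> (\<Sum>i'<n. (c * vnorm m (\<lambda>j. y j i'))\<^sup>2)"
    by (intro sum_mono power_mono op_boundD assms) simp
  also have "\<dots> = c\<^sup>2 * (\<Sum>j<m. (vnorm n (mapply n B (\<lambda>j'. v (j * n + j'))))\<^sup>2)"
    by (simp add: power_mult_distrib vnorm_sq y_def flip: sum_distrib_left) (intro disjI2 sum.swap)
  also have "\<dots> \<le> c\<^sup>2 * (\<Sum>j<m. (d * vnorm n (\<lambda>j'. v (j * n + j')))\<^sup>2)"
    by (intro mult_left_mono sum_mono power_mono op_boundD assms) auto
  also have "\<dots> = (c * d * vnorm (m * n) v)\<^sup>2"
    by (simp add: power_mult_distrib vnorm_sq sum_lessThan_mult mult.assoc flip: sum_distrib_left)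
  finally show "vnorm (m * n) (mapply (m * n) (kron A B) v) \<le> c * d * vnorm (m * n) v"
    by (rule power2_le_imp_le) (simp add: cd)
qed

text \<open>Splitting every index into quotient and remainder by \<open>n\<close> turns the sum in
  the matrix product into a product of two sums.\<close>

lemma kron_mult:
  assumes "A \<in> carrier_mat m m" "A' \<in> carrier_mat m m" "B \<in> carrier_mat n n" "B' \<in> carrier_mat n n"
  shows "kron A B * kron A' B' = kron (A * A') (B * B')"
proof (rule eq_matI)
  note K = kron_carrier[OF assms(1,3)] kron_carrier[OF assms(2,4)]
    kron_carrier[OF mult_carrier_mat[OF assms(1,2)] mult_carrier_mat[OF assms(3,4)]]
  fix x y assume "x < dim_row (kron (A * A') (B * B'))" "y < dim_col (kron (A * A') (B * B'))"
  then have xy: "x < m * n" "y < m * n" using K by auto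
  define i i' j j' where "i = x div n" "i' = x mod n" "j = y div n" "j' = y mod n"
  have ij: "x = i * n + i'" "y = j * n + j'" by (simp_all add: i_i'_j_j'_def)
  have n: "0 < n" using xy by (cases n) auto
  then have lt: "i < m" "i' < n" "j < m" "j' < n"
    using xy by (auto simp: i_i'_j_j'_def less_mult_imp_div_less)
  have "(kron A B * kron A' B') $$ (x, y) = (\<Sum>k<m * n. kron A B $$ (x, k) * kron A' B' $$ (k, y))"
    using K xy by (simp add: scalar_prod_def atLeast0LessThan)
  also have "\<dots> = (\<Sum>k<m. \<Sum>k'<n. (A $$ (i, k) * A' $$ (k, j)) * (B $$ (i', k') * B' $$ (k', j')))"
    using lt by (simp add: sum_lessThan_mult ij kron_index[OF assms(1,3)] kron_index[OF assms(2,4)] mult_ac)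
  also have "\<dots> = (A * A') $$ (i, j) * (B * B') $$ (i', j')"
    using lt assms by (simp add: scalar_prod_def atLeast0LessThan sum_product)
  also have "\<dots> = kron (A * A') (B * B') $$ (x, y)"
    unfolding ij by (rule kron_index[symmetric, of _ m _ n]) (use assms lt in auto)
  finally show "(kron A B * kron A' B') $$ (x, y) = kron (A * A') (B * B') $$ (x, y)" .
qed (use assms in \<open>simp_all add: kron_def\<close>)

lemma kron_list_mult:
  assumes "length As = length Bs"
    and "\<And>A. A \<in> set As \<Longrightarrow> A \<in> carrier_mat D D" "\<And>B. B \<in> set Bs \<Longrightarrow> B \<in> carrier_mat D D"
  shows "kron_list As * kron_list Bs = kron_list (map2 (*) As Bs)"
  using assms
proof (induction As Bs rule: list_induct2)
  case Nil
  then show ?case by (simp add: kron_list_def)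
next
  case (Cons A As B Bs)
  then have "kron_list As \<in> carrier_mat (D ^ length As) (D ^ length As)"
    "kron_list Bs \<in> carrier_mat (D ^ length As) (D ^ length As)"
    using kron_list_carrier[of As D] kron_list_carrier[of Bs D] by auto
  then show ?case
    using Cons by (simp add: kron_list_Cons kron_mult[of A D B])
qed

text \<open>Each factor carries its own bound, so that positions where two codewords agree can
  contribute 1 and the other positions a constant below 1.\<close>

lemma op_bound_kron_list:
  assumes "length As = length cs"
    and "\<And>A. A \<in> set As \<Longrightarrow> A \<in> carrier_mat D D"
    and "\<And>A c. (A, c) \<in> set (zip As cs) \<Longrightarrow> op_bound D A c"
  shows "op_bound (D ^ length As) (kron_list As) (prod_list cs)"
  using assms
proof (induction As cs rule: list_induct2)
  case Nil
  have "(1\<^sub>m (Suc 0) :: complex mat) $$ (0, 0) = 1" by simp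
  then show ?case by (simp add: kron_list_def op_bound_def vnorm_def mapply_def lessThan_Suc)
next
  case (Cons A As c cs)
  then have "kron_list As \<in> carrier_mat (D ^ length As) (D ^ length As)"
    using kron_list_carrier[of As D] by auto
  then show ?case
    using Cons op_bound_kron[of A D "kron_list As" "D ^ length As" c "prod_list cs"]
    by (simp add: kron_list_Cons)
qed

lemma kron_list_hermitian:
  assumes "\<And>A. A \<in> set As \<Longrightarrow> A \<in> carrier_mat D D"
    and "\<And>A i j. A \<in> set As \<Longrightarrow> i < D \<Longrightarrow> j < D \<Longrightarrow> A $$ (i, j) = cnj (A $$ (j, i))"
    and "i < D ^ length As" "j < D ^ length As"
  shows "kron_list As $$ (i, j) = cnj (kron_list As $$ (j, i))"
  using assms
proof (induction As arbitrary: i j)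
  case Nil
  then show ?case by (simp add: kron_list_def)
next
  case (Cons A As)
  have D: "0 < D ^ length As" using Cons.prems(3) by (cases "D = 0") auto
  have hi: "i div D ^ length As < D" "j div D ^ length As < D"
    using Cons.prems(3,4) by (auto simp: less_mult_imp_div_less)
  have lo: "i mod D ^ length As < D ^ length As" "j mod D ^ length As < D ^ length As"
    using D by (simp_all only: mod_less_divisor)
  have "kron_list As $$ (i mod D ^ length As, j mod D ^ length As)
      = cnj (kron_list As $$ (j mod D ^ length As, i mod D ^ length As))"
    by (rule Cons.IH[OF _ _ lo]) (blast intro: Cons.prems(1,2) list.set_intros(2))+
  moreover have "A $$ (i div D ^ length As, j div D ^ length As)
      = cnj (A $$ (j div D ^ length As, i div D ^ length As))"
    by (rule Cons.prems(2)[OF _ hi]) simp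
  ultimately show ?case
    using Cons.prems(1,3,4) kron_list_Cons_index[of A D As i j] kron_list_Cons_index[of A D As j i]
    by simp
qed

section \<open>Density operators\<close>

text \<open>Cholesky-type induction on the dimension: the last row and column split off a rank-one
  term, and the Schur complement that remains is again positive semidefinite.\<close>

lemma psd_factorization:
  fixes A :: "nat \<Rightarrow> nat \<Rightarrow> complex"
  assumes "\<And>i j. i < n \<Longrightarrow> j < n \<Longrightarrow> A i j = cnj (A j i)"
    and "\<And>v. 0 \<le> Re (\<Sum>i<n. \<Sum>j<n. cnj (v i) * A i j * v j)"
  shows "\<exists>W. \<forall>i<n. \<forall>j<n. A i j = (\<Sum>k<n. W k i * cnj (W k j))"
  using assms
proof (induction n arbitrary: A)
  case 0
  then show ?case by simp
next
  case (Suc n)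
  note herm = Suc.prems(1)
  define \<alpha> where "\<alpha> = Re (A n n)"
  have Ann: "A n n = of_real \<alpha>"
    using herm[of n n] by (simp add: \<alpha>_def complex_eq_iff)
  define b where "b v = (\<Sum>j<n. A n j * v j)" for v
  \<comment> \<open>The last coordinate is separated from the quadratic form. By hermiticity the
    last-row and last-column sums are conjugate, hence the doubled real part.\<close>
  have expand: "Re (\<Sum>i<Suc n. \<Sum>j<Suc n. cnj (v i) * A i j * v j)
      = Re (\<Sum>i<n. \<Sum>j<n. cnj (v i) * A i j * v j) + 2 * Re (cnj (v n) * b v)
        + \<alpha> * (cmod (v n))\<^sup>2" for v
  proof -
    have row: "(\<Sum>j<n. cnj (v n) * A n j * v j) = cnj (v n) * b v"
      by (simp add: b_def sum_distrib_left mult.assoc)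
    have "(\<Sum>i<n. cnj (v i) * A i n * v n) = (\<Sum>i<n. cnj (cnj (v n) * (A n i * v i)))"
      using herm[of _ n] by (intro sum.cong refl) (simp add: mult_ac)
    then have column: "(\<Sum>i<n. cnj (v i) * A i n * v n) = cnj (cnj (v n) * b v)"
      by (simp add: b_def sum_distrib_left)
    have corner: "Re (cnj (v n) * A n n * v n) = \<alpha> * (cmod (v n))\<^sup>2"
      unfolding Ann cmod_power2 by (simp add: algebra_simps power2_eq_square)
    show ?thesis
      by (simp only: sum.lessThan_Suc sum.distrib row column plus_complex.sel corner cnj.sel)
  qed
  have \<alpha>: "0 \<le> \<alpha>"
    using Suc.prems(2)[of "\<lambda>i. if i = n then 1 else 0"] unfolding expand by (simp add: b_def)
  have zero: "A n j = 0" if "\<alpha> = 0" "j < n" for j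
  proof (rule ccontr)
    assume nz: "A n j \<noteq> 0"
    \<comment> \<open>A zero pivot makes the form affine in \<open>s\<close> along the test vector
      \<open>v\<close>, with value \<open>Re (A j j) - 2 * s * (cmod (A n j))\<^sup>2\<close>. This
      choice of \<open>s\<close> makes it -1, contradicting positivity.\<close>
    define s where "s = (Re (A j j) + 1) / (2 * (cmod (A n j))\<^sup>2)"
    define v where "v i = (if i = j then 1 else if i = n then - of_real s * A n j else 0)" for i
    have v: "v n = - of_real s * A n j" "\<And>i. i < n \<Longrightarrow> v i = (if i = j then 1 else 0)"
      using that by (auto simp: v_def)
    have "b v = (\<Sum>k<n. if k = j then A n k else 0)"
      unfolding b_def by (intro sum.cong refl) (simp add: v(2))
    also have "\<dots> = A n j" using that by simp
    finally have "b v = A n j" .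
    moreover have "(\<Sum>i<n. \<Sum>k<n. cnj (v i) * A i k * v k) = A j j"
    proof -
      have "(\<Sum>k<n. cnj (v i) * A i k * v k) = (if i = j then A j j else 0)" if "i < n" for i
      proof -
        have "(\<Sum>k<n. cnj (v i) * A i k * v k) = (\<Sum>k<n. if k = j then cnj (v i) * A i k else 0)"
          by (intro sum.cong refl) (simp add: v(2))
        then show ?thesis using that \<open>j < n\<close> by (simp add: v(2))
      qed
      then show ?thesis using \<open>j < n\<close> by simp
    qed
    moreover have "2 * Re (cnj (v n) * A n j) = - (Re (A j j) + 1)"
    proof -
      have "cnj (v n) * A n j = of_real (- s * (cmod (A n j))\<^sup>2)"
        unfolding v(1) of_real_mult complex_norm_square by simp
      moreover have "2 * (s * (cmod (A n j))\<^sup>2) = Re (A j j) + 1"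
        using nz by (simp add: s_def)
      ultimately show ?thesis by (simp only: Re_complex_of_real)
    qed
    ultimately show False
      using Suc.prems(2)[of v] that(1) unfolding expand by simp
  qed
  \<comment> \<open>Schur complement; for \<open>\<alpha> = 0\<close> the convention \<open>x / 0 = 0\<close> makes the correction vanish, as it should.\<close>
  define A' where "A' i j = A i j - A i n * A n j / of_real \<alpha>" for i j
  have "\<exists>W. \<forall>i<n. \<forall>j<n. A' i j = (\<Sum>k<n. W k i * cnj (W k j))"
  proof (rule Suc.IH)
    show "A' i j = cnj (A' j i)" if "i < n" "j < n" for i j
      using that herm[of i j] herm[of i n] herm[of n j] by (simp add: A'_def mult.commute)
    fix v :: "nat \<Rightarrow> complex"
    \<comment> \<open>For \<alpha> > 0 this last coordinate minimizes the form of \<open>A\<close>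
      over all extensions of \<open>v\<close>, and the minimum is the form of \<open>A'\<close> at
      \<open>v\<close>. For \<alpha> = 0 division by zero gives 0 in both corrections, so the two
      forms still agree.\<close>
    define u where "u i = (if i = n then - b v / of_real \<alpha> else v i)" for i
    have u: "u n = - b v / of_real \<alpha>" "\<And>i. i < n \<Longrightarrow> u i = v i" by (auto simp: u_def)
    have bu: "b u = b v" by (simp add: b_def u(2))
    have "(\<Sum>i<n. cnj (v i) * A i n) = (\<Sum>i<n. cnj (A n i * v i))"
      using herm[of _ n] by (intro sum.cong refl) (simp add: mult_ac)
    then have col: "(\<Sum>i<n. cnj (v i) * A i n) = cnj (b v)" by (simp add: b_def)
    have "(\<Sum>i<n. \<Sum>j<n. cnj (v i) * A' i j * v j)
        = (\<Sum>i<n. \<Sum>j<n. cnj (v i) * A i j * v j) -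
          (\<Sum>i<n. \<Sum>j<n. (cnj (v i) * A i n) * (A n j * v j)) / of_real \<alpha>"
      by (simp add: A'_def algebra_simps sum_subtractf sum_divide_distrib)
    also have "(\<Sum>i<n. \<Sum>j<n. (cnj (v i) * A i n) * (A n j * v j)) = cnj (b v) * b v"
      by (simp only: sum_product[symmetric] col flip: b_def)
    also have "\<dots> = of_real ((cmod (b v))\<^sup>2)"
      by (simp only: mult.commute[of "cnj _"] complex_norm_square)
    finally have "Re (\<Sum>i<n. \<Sum>j<n. cnj (v i) * A' i j * v j)
        = Re (\<Sum>i<n. \<Sum>j<n. cnj (v i) * A i j * v j) - (cmod (b v))\<^sup>2 / \<alpha>"
      by (simp flip: of_real_divide of_real_power)
    also have "\<dots> = Re (\<Sum>i<Suc n. \<Sum>j<Suc n. cnj (u i) * A i j * u j)"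
    proof -
      have "cnj (u n) * b v = of_real (- ((cmod (b v))\<^sup>2 / \<alpha>))"
        unfolding u(1) of_real_minus of_real_divide complex_norm_square by simp
      then have "2 * Re (cnj (u n) * b u) = - 2 * ((cmod (b v))\<^sup>2 / \<alpha>)"
        unfolding bu by (simp only: Re_complex_of_real)
      moreover have "\<alpha> * (cmod (u n))\<^sup>2 = (cmod (b v))\<^sup>2 / \<alpha>"
        unfolding u(1) using \<alpha> by (simp add: norm_divide power_divide power2_eq_square)
      ultimately show ?thesis unfolding expand by (simp add: u(2))
    qed
    finally show "0 \<le> Re (\<Sum>i<n. \<Sum>j<n. cnj (v i) * A' i j * v j)"
      using Suc.prems(2)[of u] by simp
  qed
  then obtain W where W: "\<And>i j. i < n \<Longrightarrow> j < n \<Longrightarrow> A' i j = (\<Sum>k<n. W k i * cnj (W k j))"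
    by blast
  \<comment> \<open>The new rank-one term is the last column of \<open>A\<close>, scaled by the root
    of the pivot. The old vectors get last coordinate 0 and so leave the last row and column
    untouched.\<close>
  define W' where
    "W' k i = (if k = n then A i n / of_real (sqrt \<alpha>) else if i = n then 0 else W k i)" for k i
  have prod: "W' n i * cnj (W' n j) = A i n * A n j / of_real \<alpha>" if "i < Suc n" "j < Suc n" for i j
    using that \<alpha> herm[of n j] by (simp add: W'_def flip: of_real_mult)
  have "A i j = (\<Sum>k<Suc n. W' k i * cnj (W' k j))" if ij: "i < Suc n" "j < Suc n" for i j
  proof (cases "i < n \<and> j < n")
    case True
    then have "(\<Sum>k<n. W' k i * cnj (W' k j)) = A' i j" by (simp add: W W'_def)
    then show ?thesis using prod[OF ij] by (simp add: A'_def)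
  next
    case False
    then have "(\<Sum>k<n. W' k i * cnj (W' k j)) = 0"
      using ij
      by (intro sum.neutral) (auto simp: W'_def)
    \<comment> \<open>On the last row and column the new term must reproduce \<open>A\<close> by
      itself. If \<alpha> = 0, both sides vanish by \<open>zero\<close>.\<close>
    moreover have "A i n * A n j / of_real \<alpha> = A i j"
    proof (cases "\<alpha> = 0")
      case True
      consider "i = n" "j = n" | "i = n" "j < n" | "i < n" "j = n"
        using False ij by linarith
      then have "A i j = 0"
      proof cases
        case 3
        then show ?thesis using zero[OF True, of i] herm[of i n] by simp
      qed (use Ann True zero[OF True] in simp_all)
      then show ?thesis using True by simp
    next
      case nz: False
      then show ?thesis using False ij Ann by (cases "i = n") (auto simp: less_Suc_eq)
    qed
    ultimately show ?thesis using prod[OF ij] by simp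
  qed
  then show ?case by blast
qed

text \<open>Presents \<rho> as a mixture of unnormalized pure states \<open>W k\<close>, in general
  not orthogonal. Expectations become sums of quadratic forms, and trace one says that the squared
  norms are weights of total 1.\<close>

lemma density_operator_factorization:
  assumes "density_operator n \<rho>"
  shows "\<exists>W. (\<forall>X \<in> carrier_mat n n.
      mat_trace (\<rho> * X) = (\<Sum>k<n. sprod n (W k) (mapply n X (W k)))) \<and>
    (\<Sum>k<n. (vnorm n (W k))\<^sup>2) = 1"
proof -
  have \<rho>: "\<rho> \<in> carrier_mat n n" and adj: "mat_adjoint \<rho> = \<rho>"
    and pos: "\<And>v. v \<in> carrier_vec n \<Longrightarrow> 0 \<le> (\<rho> *\<^sub>v v) \<bullet>c v" and tr: "mat_trace \<rho> = 1"
    using assms by (auto simp: density_operator_def)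
  have "\<exists>W. \<forall>i<n. \<forall>j<n. \<rho> $$ (i, j) = (\<Sum>k<n. W k i * cnj (W k j))"
  proof (rule psd_factorization)
    fix i j assume "i < n" "j < n"
    then have "mat_adjoint \<rho> $$ (i, j) = cnj (\<rho> $$ (j, i))"
      using \<rho> by (simp add: mat_adjoint_def mat_of_rows_index)
    then show "\<rho> $$ (i, j) = cnj (\<rho> $$ (j, i))" unfolding adj .
  next
    fix v :: "nat \<Rightarrow> complex"
    have "(\<rho> *\<^sub>v vec n v) \<bullet>c vec n v = (\<Sum>i<n. \<Sum>j<n. cnj (v i) * \<rho> $$ (i, j) * v j)"
      using \<rho> by (simp add: scalar_prod_def atLeast0LessThan sum_distrib_left mult_ac)
    then show "0 \<le> Re (\<Sum>i<n. \<Sum>j<n. cnj (v i) * \<rho> $$ (i, j) * v j)"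
      using pos[of "vec n v"] by (simp add: less_eq_complex_def)
  qed
  then obtain W where W: "\<And>i j. i < n \<Longrightarrow> j < n \<Longrightarrow> \<rho> $$ (i, j) = (\<Sum>k<n. W k i * cnj (W k j))"
    by blast
  have trace: "mat_trace (\<rho> * X) = (\<Sum>k<n. sprod n (W k) (mapply n X (W k)))"
    if X: "X \<in> carrier_mat n n" for X
  proof -
    have "mat_trace (\<rho> * X) = (\<Sum>a<n. \<Sum>b<n. \<Sum>k<n. cnj (W k b) * (X $$ (b, a) * W k a))"
      by (simp add: mat_trace_mult[OF \<rho> X] W sum_distrib_right)
        (simp only: mult_ac)
    also have "\<dots> = (\<Sum>a<n. \<Sum>k<n. \<Sum>b<n. cnj (W k b) * (X $$ (b, a) * W k a))"
      by (intro sum.cong refl sum.swap)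
    also have "\<dots> = (\<Sum>k<n. \<Sum>a<n. \<Sum>b<n. cnj (W k b) * (X $$ (b, a) * W k a))"
      by (rule sum.swap)
    also have "\<dots> = (\<Sum>k<n. \<Sum>b<n. \<Sum>a<n. cnj (W k b) * (X $$ (b, a) * W k a))"
      by (intro sum.cong refl sum.swap)
    finally show ?thesis by (simp add: sprod_def mapply_def sum_distrib_left)
  qed
  have "complex_of_real (\<Sum>k<n. (vnorm n (W k))\<^sup>2) = (\<Sum>k<n. \<Sum>a<n. W k a * cnj (W k a))"
    by (simp only: vnorm_sq of_real_sum complex_norm_square)
  also have "\<dots> = (\<Sum>a<n. \<rho> $$ (a, a))"
    by (simp add: W) (rule sum.swap)
  also have "\<dots> = 1" using tr \<rho> by (simp add: mat_trace_def)
  finally have "(\<Sum>k<n. (vnorm n (W k))\<^sup>2) = 1" by (simp only: of_real_eq_1_iff)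
  with trace show ?thesis by blast
qed

text \<open>A Bessel inequality for almost orthogonal contractions: with all cross products zero the
  factor would be 1, and each ordered pair of indices adds at most \<eta> to it.\<close>

lemma sum_vnorm_sq_le:
  assumes fin: "finite I" and carr: "\<And>i. i \<in> I \<Longrightarrow> K i \<in> carrier_mat n n"
    and herm: "\<And>i a b. i \<in> I \<Longrightarrow> a < n \<Longrightarrow> b < n \<Longrightarrow> K i $$ (a, b) = cnj (K i $$ (b, a))"
    and contr: "\<And>i. i \<in> I \<Longrightarrow> op_bound n (K i) 1"
    and cross: "\<And>i j. i \<in> I \<Longrightarrow> j \<in> I \<Longrightarrow> i \<noteq> j \<Longrightarrow> op_bound n (K i * K j) \<eta>"
    and \<eta>: "0 \<le> \<eta>"
  shows "(\<Sum>i\<in>I. (vnorm n (mapply n (K i) w))\<^sup>2) \<le> (1 + (real (card I))\<^sup>2 * \<eta>) * (vnorm n w)\<^sup>2"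
proof -
  define u where "u i = mapply n (K i) w" for i
  \<comment> \<open>This is the sum of all \<open>K i * K i\<close> applied to \<open>w\<close>, so
    hermiticity gives \<open>x\<close> as the scalar product of \<open>w\<close> and
    \<open>z\<close>. Estimating the norm of \<open>z\<close> in terms of \<open>x\<close> closes
    the loop.\<close>
  define z where "z a = (\<Sum>i\<in>I. mapply n (K i) (u i) a)" for a
  define x where "x = (\<Sum>i\<in>I. (vnorm n (u i))\<^sup>2)"
  define t where "t = (vnorm n w)\<^sup>2"
  define h where "h = (real (card I))\<^sup>2 * \<eta>"
  have x0: "0 \<le> x" and t0: "0 \<le> t" and h0: "0 \<le> h"
    using \<eta> by (auto simp: x_def t_def h_def intro!: sum_nonneg)
  have move: "sprod n v (mapply n (K i) v') = sprod n (mapply n (K i) v) v'" if "i \<in> I" for i v v'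
    by (rule sprod_mapply_hermitian) (rule herm[OF that])
  have u_le: "vnorm n (u i) \<le> vnorm n w" if "i \<in> I" for i
    using op_boundD[OF contr[OF that], of w] by (simp add: u_def)
  have "complex_of_real x = (\<Sum>i\<in>I. sprod n w (mapply n (K i) (u i)))"
    by (simp add: x_def move sprod_self flip: u_def)
  also have "\<dots> = sprod n w z" unfolding z_def by (rule sprod_sum_right[symmetric])
  finally have "x = cmod (sprod n w z)" using x0 by (metis abs_of_nonneg norm_of_real)
  also have "\<dots> \<le> vnorm n w * vnorm n z" by (rule sprod_bound)
  finally have xle: "x\<^sup>2 \<le> t * (vnorm n z)\<^sup>2"
    using x0 by (metis t_def power_mono power_mult_distrib)
  \<comment> \<open>On the diagonal the contraction property suffices; off it, \<open>K i\<close> is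
    moved across the scalar product to form \<open>K i * K j\<close>. The term \<eta> *
    \<open>t\<close> is granted to diagonal pairs as well, which makes the total error exactly
    \<open>h * t\<close>.\<close>
  have pair: "Re (sprod n (mapply n (K i) (u i)) (mapply n (K j) (u j)))
      \<le> (if i = j then (vnorm n (u i))\<^sup>2 else 0) + \<eta> * t" if "i \<in> I" "j \<in> I" for i j
  proof (cases "i = j")
    case True
    have "(vnorm n (mapply n (K i) (u i)))\<^sup>2 \<le> (vnorm n (u i))\<^sup>2"
      using op_boundD[OF contr[OF that(1)], of "u i"] by (intro power_mono) auto
    moreover have "0 \<le> \<eta> * t" using \<eta> t0 by simp
    ultimately show ?thesis unfolding True[symmetric] sprod_self Re_complex_of_real if_P[OF refl] by linarith
  next
    case False
    have "sprod n (mapply n (K i) (u i)) (mapply n (K j) (u j))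
        = sprod n (u i) (mapply n (K i) (mapply n (K j) (u j)))"
      by (simp only: move[OF that(1)])
    also have "\<dots> = sprod n (u i) (mapply n (K i * K j) (u j))"
      unfolding sprod_def using mapply_mult[OF carr carr] that by (intro sum.cong refl) simp
    also have "Re \<dots> \<le> vnorm n (u i) * vnorm n (mapply n (K i * K j) (u j))"
      by (rule order_trans[OF complex_Re_le_cmod sprod_bound])
    also have "\<dots> \<le> vnorm n w * (\<eta> * vnorm n w)"
    proof (rule mult_mono[OF u_le[OF that(1)]])
      have "vnorm n (mapply n (K i * K j) (u j)) \<le> \<eta> * vnorm n (u j)"
        by (rule op_boundD[OF cross[OF that False]])
      also have "\<dots> \<le> \<eta> * vnorm n w" by (rule mult_left_mono[OF u_le[OF that(2)] \<eta>])
      finally show "vnorm n (mapply n (K i * K j) (u j)) \<le> \<eta> * vnorm n w" .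
    qed auto
    finally show ?thesis using False by (simp add: t_def power2_eq_square mult_ac)
  qed
  have "(vnorm n z)\<^sup>2 = Re (sprod n z z)" by (simp add: sprod_self)
  also have "sprod n z z = (\<Sum>i\<in>I. \<Sum>j\<in>I. sprod n (mapply n (K i) (u i)) (mapply n (K j) (u j)))"
    unfolding z_def sprod_sum_left sprod_sum_right ..
  also have "Re \<dots> \<le> (\<Sum>i\<in>I. \<Sum>j\<in>I. (if i = j then (vnorm n (u i))\<^sup>2 else 0) + \<eta> * t)"
    unfolding Re_sum by (intro sum_mono pair)
  also have "\<dots> = x + h * t"
    using fin by (simp add: sum.distrib x_def h_def power2_eq_square mult_ac)
  finally have "x\<^sup>2 \<le> t * (x + h * t)"
    using xle t0 by (meson mult_left_mono order_trans)
  then have quad: "x * x \<le> t * x + t * (h * t)" by (simp add: power2_eq_square algebra_simps)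
  have "x \<le> (1 + h) * t"
  \<comment> \<open>The quadratic inequality is solved without roots: for \<open>x\<close> above
    \<open>(1 + h) * t\<close>, \<open>x * x\<close> exceeds \<open>t * x + h * t * x\<close>, and
    \<open>t \<le> x\<close> makes this at least the right-hand side of \<open>quad\<close>.\<close>
  proof (rule ccontr)
    assume "\<not> x \<le> (1 + h) * t"
    then have gt: "t + h * t < x" by (simp add: algebra_simps)
    have ht: "0 \<le> h * t" using h0 t0 by simp
    then have "t \<le> x" "0 < x" using gt t0 by linarith+
    then have "(t + h * t) * x < x * x" using gt by simp
    moreover have "(h * t) * t \<le> (h * t) * x" using ht \<open>t \<le> x\<close> by (rule mult_left_mono[rotated])
    ultimately show False using quad by (simp add: algebra_simps)
  qed
  then show ?thesis by (simp add: x_def u_def t_def h_def)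
qed

text \<open>Each trace of a square is the sum over \<open>k\<close> of squared norms of
  \<open>K i\<close> applied to \<open>W k\<close>. The estimate for single vectors then applies to
  every \<open>W k\<close>, and the weights add up to 1.\<close>

lemma density_operator_sum_squares_le:
  assumes "finite I" and carr: "\<And>i. i \<in> I \<Longrightarrow> K i \<in> carrier_mat n n"
    and herm: "\<And>i a b. i \<in> I \<Longrightarrow> a < n \<Longrightarrow> b < n \<Longrightarrow> K i $$ (a, b) = cnj (K i $$ (b, a))"
    and "\<And>i. i \<in> I \<Longrightarrow> op_bound n (K i) 1"
    and "\<And>i j. i \<in> I \<Longrightarrow> j \<in> I \<Longrightarrow> i \<noteq> j \<Longrightarrow> op_bound n (K i * K j) \<eta>"
    and "0 \<le> \<eta>" and "density_operator n \<rho>"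
  shows "(\<Sum>i\<in>I. Re (mat_trace (\<rho> * (K i * K i)))) \<le> 1 + (real (card I))\<^sup>2 * \<eta>"
proof -
  obtain W where W: "\<And>X. X \<in> carrier_mat n n \<Longrightarrow>
      mat_trace (\<rho> * X) = (\<Sum>k<n. sprod n (W k) (mapply n X (W k)))"
    and W1: "(\<Sum>k<n. (vnorm n (W k))\<^sup>2) = 1"
    using density_operator_factorization[OF assms(7)] by blast
  have "sprod n v (mapply n (K i * K i) v) = of_real ((vnorm n (mapply n (K i) v))\<^sup>2)"
    if "i \<in> I" for i v
  proof -
    have "sprod n v (mapply n (K i * K i) v) = sprod n v (mapply n (K i) (mapply n (K i) v))"
      unfolding sprod_def using mapply_mult[OF carr carr] that by (intro sum.cong refl) simp
    also have "\<dots> = sprod n (mapply n (K i) v) (mapply n (K i) v)"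
      by (rule sprod_mapply_hermitian) (rule herm[OF that])
    finally show ?thesis by (simp only: sprod_self)
  qed
  then have "(\<Sum>i\<in>I. Re (mat_trace (\<rho> * (K i * K i))))
      = (\<Sum>i\<in>I. \<Sum>k<n. (vnorm n (mapply n (K i) (W k)))\<^sup>2)"
    by (intro sum.cong refl)
      (simp only: W[OF mult_carrier_mat[OF carr carr]] Re_sum Re_complex_of_real)
  also have "\<dots> = (\<Sum>k<n. \<Sum>i\<in>I. (vnorm n (mapply n (K i) (W k)))\<^sup>2)"
    by (rule sum.swap)
  also have "\<dots> \<le> (\<Sum>k<n. (1 + (real (card I))\<^sup>2 * \<eta>) * (vnorm n (W k))\<^sup>2)"
    by (rule sum_mono) (rule sum_vnorm_sq_le[OF assms(1-6)])
  also have "\<dots> = 1 + (real (card I))\<^sup>2 * \<eta>"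
    unfolding sum_distrib_left[symmetric] W1 by simp
  finally show ?thesis .
qed

section \<open>Square roots of the acceptance operators\<close>

text \<open>For a unit vector \<open>u\<close> this fixes \<open>u\<close> and multiplies its
  orthogonal complement by \<open>a\<close>. Both the single-particle check and its square root have
  this shape.\<close>

definition shrink :: "nat \<Rightarrow> real \<Rightarrow> (nat \<Rightarrow> complex) \<Rightarrow> complex mat" where
  "shrink n a u = mat n n (\<lambda>(i, j).
     complex_of_real a * (if i = j then 1 else 0) + complex_of_real (1 - a) * (u i * cnj (u j)))"

lemma shrink_carrier: "shrink n a u \<in> carrier_mat n n"
  by (simp add: shrink_def)

lemma shrink_hermitian:
  "i < n \<Longrightarrow> j < n \<Longrightarrow> shrink n a u $$ (i, j) = cnj (shrink n a u $$ (j, i))"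
  by (simp add: shrink_def mult.commute)

lemma mapply_shrink:
  assumes "i < n"
  shows "mapply n (shrink n a u) v i = of_real a * v i + of_real (1 - a) * sprod n u v * u i"
proof -
  have "mapply n (shrink n a u) v i
      = (\<Sum>j<n. if i = j then of_real a * v j else 0) + (\<Sum>j<n. of_real (1 - a) * (cnj (u j) * v j) * u i)"
    using assms unfolding mapply_def sum.distrib[symmetric]
    by (intro sum.cong refl) (simp add: shrink_def algebra_simps)
  also have "(\<Sum>j<n. of_real (1 - a) * (cnj (u j) * v j) * u i) = of_real (1 - a) * sprod n u v * u i"
    by (simp only: sprod_def sum_distrib_left sum_distrib_right)
  finally show ?thesis using assms by simp
qed

text \<open>The eigenvalue 1 on \<open>u\<close> is unchanged by squaring, and the eigenvalue
  \<open>a\<close> on the complement becomes its square.\<close>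

lemma shrink_mult_self:
  assumes "vnorm n u = 1"
  shows "shrink n a u * shrink n a u = shrink n (a\<^sup>2) u"
proof (rule eq_matI)
  fix i j assume "i < dim_row (shrink n (a\<^sup>2) u)" "j < dim_col (shrink n (a\<^sup>2) u)"
  then have ij: "i < n" "j < n" by (simp_all add: shrink_def)
  \<comment> \<open>Column \<open>j\<close> of the matrix. Its scalar product with \<open>u\<close>
    is \<open>cnj (u j)\<close>, because the hermitian matrix fixes \<open>u\<close>.\<close>
  define c where "c k = shrink n a u $$ (k, j)" for k
  have "(\<Sum>k<n. cnj (u k) * c k) = (\<Sum>k<n. if k = j then of_real a * cnj (u k) else 0)
      + (\<Sum>k<n. of_real (1 - a) * cnj (u j) * (cnj (u k) * u k))"
    using ij unfolding sum.distrib[symmetric]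
    by (intro sum.cong refl) (simp add: c_def shrink_def algebra_simps)
  also have "(\<Sum>k<n. of_real (1 - a) * cnj (u j) * (cnj (u k) * u k)) = of_real (1 - a) * cnj (u j)"
    using sprod_self[of n u] assms unfolding sum_distrib_left[symmetric] sprod_def by simp
  finally have uc: "sprod n u c = cnj (u j)"
    using ij by (simp add: sprod_def algebra_simps)
  have "(shrink n a u * shrink n a u) $$ (i, j) = mapply n (shrink n a u) c i"
    using ij shrink_carrier[of n a u]
    by (simp add: mapply_def c_def scalar_prod_def atLeast0LessThan)
  also have "\<dots> = shrink n (a\<^sup>2) u $$ (i, j)"
    using ij by (simp add: mapply_shrink uc)
      (simp add: c_def shrink_def algebra_simps power2_eq_square)
  finally show "(shrink n a u * shrink n a u) $$ (i, j) = shrink n (a\<^sup>2) u $$ (i, j)" .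
qed (simp_all add: shrink_def)

text \<open>The component along \<open>u\<close> is kept apart instead of being bounded by the norm
  of \<open>v\<close>; the gain for two different states comes from this term.\<close>

lemma vnorm_mapply_shrink_le:
  assumes "0 \<le> a" "a \<le> 1" "vnorm n u = 1"
  shows "vnorm n (mapply n (shrink n a u) v) \<le> a * vnorm n v + (1 - a) * cmod (sprod n u v)"
proof -
  have "vnorm n (mapply n (shrink n a u) v)
      = vnorm n (\<lambda>i. of_real a * v i + of_real (1 - a) * sprod n u v * u i)"
    by (rule vnorm_cong) (rule mapply_shrink)
  also have "\<dots> \<le> vnorm n (\<lambda>i. of_real a * v i) + vnorm n (\<lambda>i. of_real (1 - a) * sprod n u v * u i)"
    by (rule vnorm_triangle)
  also have "\<dots> = a * vnorm n v + (1 - a) * cmod (sprod n u v)"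
    unfolding vnorm_scale assms(3) norm_mult norm_of_real using assms by simp
  finally show ?thesis .
qed

lemma op_bound_shrink:
  assumes "0 \<le> a" "a \<le> 1" "vnorm n u = 1"
  shows "op_bound n (shrink n a u) 1"
proof -
  have "vnorm n (mapply n (shrink n a u) v) \<le> a * vnorm n v + (1 - a) * vnorm n v" for v
  proof -
    have "(1 - a) * cmod (sprod n u v) \<le> (1 - a) * vnorm n v"
      using sprod_bound[of n u v] assms by (intro mult_left_mono) simp_all
    then show ?thesis using vnorm_mapply_shrink_le[OF assms, of v] by linarith
  qed
  then show ?thesis by (simp add: op_bound_def algebra_simps)
qed

text \<open>The component along \<open>u\<close> left by the right factor is at most
  \<open>a\<close> plus \<open>1 - a\<close> times the overlap, for a unit input. Thus the weights
  \<open>a\<close>, \<open>(1 - a) * a\<close> and \<open>(1 - a)\<^sup>2\<close> sum to 1, and only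
  the last is reduced by the overlap.\<close>

lemma op_bound_shrink_mult:
  assumes a: "0 \<le> a" "a \<le> 1" and u: "vnorm n u = 1" and v: "vnorm n v = 1"
  shows "op_bound n (shrink n a u * shrink n a v) (1 - (1 - a)\<^sup>2 * (1 - cmod (sprod n u v)))"
  unfolding op_bound_def
proof (intro conjI allI)
  let ?s = "cmod (sprod n u v)"
  have s: "0 \<le> ?s" "?s \<le> 1" using sprod_bound[of n u v] u v by simp_all
  have "(1 - a)\<^sup>2 * (1 - ?s) \<le> 1 * 1"
    using a s by (intro mult_mono) (auto simp: power_le_one)
  then show "0 \<le> 1 - (1 - a)\<^sup>2 * (1 - ?s)" by simp
  fix w
  let ?Bw = "mapply n (shrink n a v) w"
  have "sprod n u ?Bw = of_real a * sprod n u w + of_real (1 - a) * sprod n v w * sprod n u v"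
  proof -
    have "sprod n u ?Bw = (\<Sum>i<n. of_real a * (cnj (u i) * w i)
        + of_real (1 - a) * sprod n v w * (cnj (u i) * v i))"
      unfolding sprod_def[of n u] by (intro sum.cong refl) (simp add: mapply_shrink algebra_simps)
    then show ?thesis
      unfolding sum.distrib sum_distrib_left[symmetric] by (simp only: sprod_def[of n u])
  qed
  also have "cmod \<dots> \<le> a * cmod (sprod n u w) + (1 - a) * cmod (sprod n v w) * ?s"
    using a by (intro order_trans[OF norm_triangle_ineq]) (simp add: norm_mult del: of_real_diff)
  also have "\<dots> \<le> a * vnorm n w + (1 - a) * vnorm n w * ?s"
    using sprod_bound[of n u w] sprod_bound[of n v w] u v a s
    by (intro add_mono mult_left_mono mult_right_mono) auto
  finally have "(1 - a) * cmod (sprod n u ?Bw) \<le> (1 - a) * (a * vnorm n w + (1 - a) * vnorm n w * ?s)"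
    using a by (intro mult_left_mono) auto
  moreover have "a * vnorm n ?Bw \<le> a * vnorm n w"
    using op_boundD[OF op_bound_shrink[OF a v], of w] a by (intro mult_left_mono) auto
  moreover have "vnorm n (mapply n (shrink n a u * shrink n a v) w) = vnorm n (mapply n (shrink n a u) ?Bw)"
    by (rule vnorm_cong) (rule mapply_mult[OF shrink_carrier shrink_carrier])
  ultimately have "vnorm n (mapply n (shrink n a u * shrink n a v) w)
      \<le> a * vnorm n w + (1 - a) * (a * vnorm n w + (1 - a) * vnorm n w * ?s)"
    using vnorm_mapply_shrink_le[OF a u, of ?Bw] by linarith
  also have "\<dots> = (1 - (1 - a)\<^sup>2 * (1 - ?s)) * vnorm n w"
    by (simp add: algebra_simps power2_eq_square)
  finally show "vnorm n (mapply n (shrink n a u * shrink n a v) w)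
      \<le> (1 - (1 - a)\<^sup>2 * (1 - ?s)) * vnorm n w" .
qed

text \<open>The equality case of Cauchy-Schwarz: if the overlap \<open>c\<close> had modulus 1,
  expanding the squared norm of \<open>u - c * v\<close> would give 1 + 1 - 1 - 1 = 0, so
  \<open>u\<close> would equal \<open>v\<close> up to the phase \<open>c\<close>.\<close>

lemma sprod_less_one:
  assumes u: "vnorm n u = 1" and v: "vnorm n v = 1"
    and distinct: "\<not> (\<exists>c. cmod c = 1 \<and> (\<forall>i<n. u i = c * v i))"
  shows "cmod (sprod n v u) < 1"
proof (rule ccontr)
  define c where "c = sprod n v u"
  assume "\<not> cmod (sprod n v u) < 1"
  then have c1: "cmod c = 1"
    using sprod_bound[of n v u] u v by (simp add: c_def)
  have "of_real ((vnorm n (\<lambda>i. u i + (- c) * v i))\<^sup>2)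
      = (\<Sum>i<n. cnj (u i) * u i + (cnj c * c) * (cnj (v i) * v i)
          - cnj c * (cnj (v i) * u i) - cnj (cnj c * (cnj (v i) * u i)))"
    unfolding sprod_self[symmetric] sprod_def by (intro sum.cong refl) (simp add: algebra_simps)
  also have "\<dots> = sprod n u u + (cnj c * c) * sprod n v v - cnj c * c - cnj (cnj c * c)"
    by (simp add: sum.distrib sum_subtractf sprod_def c_def flip: sum_distrib_left)
  also have "\<dots> = 0"
    using c1 unfolding sprod_self u v by (simp add: mult.commute[of "cnj c"] flip: complex_norm_square)
  finally have "vnorm n (\<lambda>i. u i + (- c) * v i) = 0" by (simp flip: of_real_power)
  then have "\<forall>i<n. u i = c * v i" by (simp add: vnorm_def L2_set_eq_0_iff)
  with c1 distinct show False by blast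
qed

section \<open>Single-particle checks and their roots\<close>

lemma particle_state_unit:
  assumes "particle_states D l \<psi>" "e < l * D"
  shows "vnorm D (\<lambda>i. \<psi> e $ i) = 1"
proof -
  have "0 < D" and dim: "dim_vec (\<psi> e) = D"
    using assms by (auto simp: particle_states_def)
  have "e div D < l" "e mod D < D"
    using assms(2) \<open>0 < D\<close> by (auto simp: less_mult_imp_div_less)
  moreover have "\<psi> (i * D + j) \<bullet>c \<psi> (i * D + j) = 1" if "i < l" "j < D" for i j
    using assms(1) that by (auto simp: particle_states_def)
  ultimately have "\<psi> (e div D * D + e mod D) \<bullet>c \<psi> (e div D * D + e mod D) = 1" by blast
  then have "\<psi> e \<bullet>c \<psi> e = 1" by simp
  then have "sprod D (\<lambda>i. \<psi> e $ i) (\<lambda>i. \<psi> e $ i) = 1"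
    using dim by (simp add: sprod_def scalar_prod_def atLeast0LessThan mult.commute)
  then have "(vnorm D (\<lambda>i. \<psi> e $ i))\<^sup>2 = 1"
    unfolding sprod_self by (simp only: of_real_eq_1_iff)
  then show ?thesis by (simp add: power2_eq_1_iff) (use vnorm_nonneg[of D "\<lambda>i. \<psi> e $ i"] in linarith)
qed

lemma particle_state_overlap:
  assumes "particle_states D l \<psi>" "e < l * D" "e' < l * D" "e \<noteq> e'"
  shows "cmod (sprod D (\<lambda>i. \<psi> e $ i) (\<lambda>i. \<psi> e' $ i)) < 1"
proof (rule sprod_less_one)
  have "\<psi> e \<in> carrier_vec D" "\<psi> e' \<in> carrier_vec D"
    using assms by (auto simp: particle_states_def)
  then have "(\<forall>i<D. \<psi> e' $ i = c * \<psi> e $ i) \<Longrightarrow> \<psi> e' = c \<cdot>\<^sub>v \<psi> e" for c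
    by (intro eq_vecI) auto
  then show "\<not> (\<exists>c. cmod c = 1 \<and> (\<forall>i<D. \<psi> e' $ i = c * \<psi> e $ i))"
    using assms unfolding particle_states_def by metis
qed (use particle_state_unit assms in auto)

lemma check_op_eq_shrink:
  assumes "particle_states D l \<psi>" "e < l * D"
  shows "check_op D l \<psi> e = shrink D (1 - 1 / real l) (\<lambda>i. \<psi> e $ i)"
proof -
  have "dim_vec (\<psi> e) = D" using assms by (auto simp: particle_states_def)
  then show ?thesis by (intro eq_matI) (auto simp: check_op_def shrink_def proj_def)
qed

definition check_root :: "nat \<Rightarrow> nat \<Rightarrow> (nat \<Rightarrow> complex vec) \<Rightarrow> nat \<Rightarrow> complex mat" where
  "check_root D l \<psi> e = shrink D (sqrt (1 - 1 / real l)) (\<lambda>i. \<psi> e $ i)"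

lemma check_root_carrier: "check_root D l \<psi> e \<in> carrier_mat D D"
  by (simp add: check_root_def shrink_carrier)

lemma check_root_square:
  assumes "particle_states D l \<psi>" "e < l * D"
  shows "check_root D l \<psi> e * check_root D l \<psi> e = check_op D l \<psi> e"
proof -
  have "0 < l" using assms(1) by (simp add: particle_states_def)
  then have "(sqrt (1 - 1 / real l))\<^sup>2 = 1 - 1 / real l" by simp
  then show ?thesis
    using particle_state_unit[OF assms]
    by (simp only: check_root_def shrink_mult_self check_op_eq_shrink[OF assms])
qed

lemma op_bound_check_root:
  assumes "particle_states D l \<psi>" "e < l * D"
  shows "op_bound D (check_root D l \<psi> e) 1"
proof -
  have "0 < l" using assms(1) by (simp add: particle_states_def)
  then show ?thesis
    unfolding check_root_def by (intro op_bound_shrink particle_state_unit[OF assms]) auto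
qed

text \<open>There are finitely many pairs of labels, so the largest of the individual bounds is
  still below 1. The constant depends only on the particle states and thus serves all codes at
  once.\<close>

lemma check_root_gap:
  assumes ps: "particle_states D l \<psi>"
  shows "\<exists>c. 0 \<le> c \<and> c < 1 \<and> (\<forall>e < l * D. \<forall>e' < l * D. e \<noteq> e' \<longrightarrow>
      op_bound D (check_root D l \<psi> e * check_root D l \<psi> e') c)"
proof -
  define a where "a = sqrt (1 - 1 / real l)"
  have a: "0 \<le> a" "a < 1"
    using ps by (auto simp: a_def particle_states_def)
  define b where "b e e' = 1 - (1 - a)\<^sup>2 * (1 - cmod (sprod D (\<lambda>i. \<psi> e $ i) (\<lambda>i. \<psi> e' $ i)))" for e e'
  define P where "P = {(e, e'). e < l * D \<and> e' < l * D \<and> e \<noteq> e'}"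
  have "finite P" by (rule finite_subset[of _ "{..<l * D} \<times> {..<l * D}"]) (auto simp: P_def)
  \<comment> \<open>The inserted 0 ensures \<open>0 \<le> c\<close> and keeps the set nonempty when
    there is only one label.\<close>
  define c where "c = Max (insert 0 ((\<lambda>(e, e'). b e e') ` P))"
  have bc: "b e e' \<le> c" if "(e, e') \<in> P" for e e'
    unfolding c_def using \<open>finite P\<close> that by (intro Max_ge) auto
  have "b e e' < 1" if "(e, e') \<in> P" for e e'
    using particle_state_overlap[OF ps, of e e'] that a by (simp add: P_def b_def)
  then have "c < 1" unfolding c_def using \<open>finite P\<close> by (subst Max_less_iff) auto
  moreover have "0 \<le> c" unfolding c_def using \<open>finite P\<close> by (intro Max_ge) auto
  moreover have "op_bound D (check_root D l \<psi> e * check_root D l \<psi> e') c"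
    if "e < l * D" "e' < l * D" "e \<noteq> e'" for e e'
  proof (rule op_bound_mono)
    show "op_bound D (check_root D l \<psi> e * check_root D l \<psi> e') (b e e')"
      unfolding check_root_def b_def a_def[symmetric]
      by (rule op_bound_shrink_mult) (use a particle_state_unit[OF ps] that in auto)
    show "b e e' \<le> c" using that by (intro bc) (simp add: P_def)
  qed
  ultimately show ?thesis by blast
qed

section \<open>Product roots along codewords\<close>

definition accept_root :: "nat \<Rightarrow> nat \<Rightarrow> (nat \<Rightarrow> complex vec) \<Rightarrow> nat list \<Rightarrow> complex mat" where
  "accept_root D l \<psi> w = kron_list (map (check_root D l \<psi>) w)"

lemma accept_root_carrier: "accept_root D l \<psi> w \<in> carrier_mat (D ^ length w) (D ^ length w)"
proof -
  have "kron_list (map (check_root D l \<psi>) w) \<in> carrier_mat (D ^ length (map (check_root D l \<psi>) w))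
      (D ^ length (map (check_root D l \<psi>) w))"
    by (rule kron_list_carrier) (auto simp: check_root_carrier)
  then show ?thesis by (simp add: accept_root_def)
qed

lemma accept_root_hermitian:
  "i < D ^ length w \<Longrightarrow> j < D ^ length w \<Longrightarrow>
    accept_root D l \<psi> w $$ (i, j) = cnj (accept_root D l \<psi> w $$ (j, i))"
  unfolding accept_root_def
proof (rule kron_list_hermitian)
  fix A i j
  assume "A \<in> set (map (check_root D l \<psi>) w)" "i < D" "j < D"
  then show "A $$ (i, j) = cnj (A $$ (j, i))"
    unfolding check_root_def by (auto intro: shrink_hermitian)
qed (auto simp: check_root_carrier)

lemma accept_root_mult:
  assumes "length w = length w'"
  shows "accept_root D l \<psi> w * accept_root D l \<psi> w'
    = kron_list (map2 (\<lambda>e e'. check_root D l \<psi> e * check_root D l \<psi> e') w w')"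
  unfolding accept_root_def
  by (subst kron_list_mult[of _ _ D])
    (use assms in \<open>auto simp: check_root_carrier zip_map1 zip_map2 comp_def case_prod_unfold\<close>)

lemma accept_root_square:
  assumes "particle_states D l \<psi>" "set w \<subseteq> {..<l * D}"
  shows "accept_root D l \<psi> w * accept_root D l \<psi> w = accept_op D l \<psi> w"
proof -
  have "map2 (\<lambda>e e'. check_root D l \<psi> e * check_root D l \<psi> e') w w = map (check_op D l \<psi>) w"
    using assms by (intro nth_equalityI) (auto simp: check_root_square subset_iff)
  then show ?thesis by (simp add: accept_root_mult accept_op_def)
qed

lemma op_bound_accept_root:
  assumes "particle_states D l \<psi>" "set w \<subseteq> {..<l * D}"
  shows "op_bound (D ^ length w) (accept_root D l \<psi> w) 1"
proof -
  have "op_bound (D ^ length (map (check_root D l \<psi>) w)) (accept_root D l \<psi> w)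
      (prod_list (replicate (length w) 1))"
    unfolding accept_root_def
    by (rule op_bound_kron_list)
      (use assms in \<open>auto simp: check_root_carrier in_set_zip subset_iff intro!: op_bound_check_root\<close>)
  then show ?thesis by simp
qed

text \<open>The exponent is the Hamming distance, which is the quantity that the code
  controls.\<close>

lemma prod_list_power_card:
  fixes c :: "'a::comm_monoid_mult"
  assumes "length w = length w'"
  shows "prod_list (map2 (\<lambda>e e'. if e = e' then 1 else c) w w')
    = c ^ card {i. i < length w \<and> w ! i \<noteq> w' ! i}"
proof -
  have "prod_list (map2 (\<lambda>e e'. if e = e' then 1 else c) w w')
      = (\<Prod>i<length w. if w ! i = w' ! i then 1 else c)"
    using assms by (simp add: prod.list_conv_set_nth atLeast0LessThan)
  also have "\<dots> = (\<Prod>i\<in>{i \<in> {..<length w}. w ! i \<noteq> w' ! i}. c)"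
    by (subst prod.inter_filter) (auto intro: prod.cong)
  finally show ?thesis by simp
qed

text \<open>The product is taken position by position. Equal labels give a product of two
  contractions, different labels give at most \<open>c\<close>, and since \<open>c < 1\<close> the
  Hamming distance may be lowered to \<open>d\<close>.\<close>

lemma op_bound_accept_root_mult:
  assumes ps: "particle_states D l \<psi>" and w: "set w \<subseteq> {..<l * D}" "set w' \<subseteq> {..<l * D}"
    and len: "length w = length w'" and c: "0 \<le> c" "c < 1"
    and gap: "\<And>e e'. e < l * D \<Longrightarrow> e' < l * D \<Longrightarrow> e \<noteq> e' \<Longrightarrow>
      op_bound D (check_root D l \<psi> e * check_root D l \<psi> e') c"
    and d: "d \<le> card {i. i < length w \<and> w ! i \<noteq> w' ! i}"
  shows "op_bound (D ^ length w) (accept_root D l \<psi> w * accept_root D l \<psi> w') (c ^ d)"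
proof (rule op_bound_mono)
  let ?As = "map2 (\<lambda>e e'. check_root D l \<psi> e * check_root D l \<psi> e') w w'"
  let ?cs = "map2 (\<lambda>e e'. if e = e' then 1 else c) w w'"
  have "op_bound (D ^ length ?As) (kron_list ?As) (prod_list ?cs)"
  proof (rule op_bound_kron_list)
    fix A k assume "(A, k) \<in> set (zip ?As ?cs)"
    then obtain i where i: "i < length w" and A: "A = check_root D l \<psi> (w ! i) * check_root D l \<psi> (w' ! i)"
      and k: "k = (if w ! i = w' ! i then 1 else c)"
      using len by (auto simp: in_set_zip)
    have lt: "w ! i < l * D" "w' ! i < l * D"
      using w i len by (auto simp: subset_iff)
    show "op_bound D A k"
    proof (cases "w ! i = w' ! i")
      case True
      then show ?thesis
        using op_bound_mult[OF check_root_carrier check_root_carrier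
            op_bound_check_root[OF ps lt(1)] op_bound_check_root[OF ps lt(2)]]
        by (simp add: A k)
    qed (use gap[OF lt] A k in auto)
  qed (auto intro!: mult_carrier_mat[OF check_root_carrier check_root_carrier])
  then show "op_bound (D ^ length w) (accept_root D l \<psi> w * accept_root D l \<psi> w')
      (c ^ card {i. i < length w \<and> w ! i \<noteq> w' ! i})"
    using len by (simp add: accept_root_mult prod_list_power_card)
  show "c ^ card {i. i < length w \<and> w ! i \<noteq> w' ! i} \<le> c ^ d"
    using d c by (intro power_decreasing) auto
qed

section \<open>Binding\<close>

theorem theorem2:
  fixes D l r :: nat and \<psi> :: "nat \<Rightarrow> complex vec"
    and G :: "('g, 'm) monoid_scheme" and U :: "'g \<Rightarrow> complex mat"
    and R \<delta> \<epsilon> :: real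
  assumes "particle_states D l \<psi>" and "symmetric_under G U D l \<psi>"
    and "R > 0" and "\<delta> > 0" and "r > 0" and "\<epsilon> > 0"
  shows "\<exists>n\<^sub>0 :: int. \<forall>(N :: nat) (n' :: nat) (d :: nat) (E :: nat list \<Rightarrow> nat list).
    error_correcting_code (l * D) N n' d E \<and> real n' / real N = R \<and> real d / real N = \<delta> \<and>
    bit_length (l * D) n' \<ge> n\<^sub>0 \<longrightarrow>
    (\<forall>(A :: nat \<Rightarrow> nat list) (\<rho> :: complex mat).
      (\<forall>i \<in> {1..r}. A i \<in> words (l * D) n') \<and> inj_on A {1..r} \<and> density_operator (D ^ N) \<rho> \<longrightarrow>
      (\<Sum>i = 1..r. accept_prob D l \<psi> \<rho> (E (A i))) \<le> 1 + \<epsilon>)"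
proof -
  note ps = assms(1)
  obtain c where c: "0 \<le> c" "c < 1" and gap: "\<And>e e'. e < l * D \<Longrightarrow> e' < l * D \<Longrightarrow> e \<noteq> e' \<Longrightarrow>
      op_bound D (check_root D l \<psi> e * check_root D l \<psi> e') c"
    using check_root_gap[OF ps] by blast
  \<comment> \<open>A distance at which the total error
    \<open>(real r)\<^sup>2 * c ^ d\<^sub>0\<close> is at most \<epsilon>, fixed before any code is
    considered.\<close>
  obtain d\<^sub>0 where "c ^ d\<^sub>0 < \<epsilon> / (real r)\<^sup>2"
    using real_arch_pow_inv[of "\<epsilon> / (real r)\<^sup>2" c] c assms(5,6) by auto
  then have d\<^sub>0: "(real r)\<^sup>2 * c ^ d\<^sub>0 \<le> \<epsilon>"
    using assms(5) by (simp add: pos_less_divide_eq mult.commute)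
  define L where "L = log 2 (real (l * D))"
  have "0 < l * D" using ps by (simp add: particle_states_def)
  then have "1 \<le> real (l * D)" by linarith
  then have L: "0 \<le> L" by (simp add: L_def del: of_nat_mult)
  \<comment> \<open>At fixed ratios \<open>d\<close> exceeds \<open>d\<^sub>0\<close> as soon as
    \<open>n'\<close> exceeds \<open>d\<^sub>0 * R / \<delta>\<close>, and each letter carries
    \<open>L\<close> bits. The added 2 absorbs the rounding up in \<open>bit_length\<close>.\<close>
  define n\<^sub>0 where "n\<^sub>0 = \<lceil>real d\<^sub>0 * R / \<delta> * L\<rceil> + 2"
  have large: "d\<^sub>0 \<le> d"
    if "real n' / real N = R" "real d / real N = \<delta>" "n\<^sub>0 \<le> bit_length (l * D) n'" for N n' d
  proof -
    \<comment> \<open>Division by zero yields 0, so \<open>N = 0\<close> would contradict \<delta> >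
      0.\<close>
    have "N \<noteq> 0" using that(2) assms(4) by (cases "N = 0") auto
    then have n': "real n' = R * real N" and d: "real d = \<delta> * real N"
      using that by (auto simp: field_simps)
    have "real d\<^sub>0 * R / \<delta> * L + 2 \<le> real_of_int n\<^sub>0"
      by (simp add: n\<^sub>0_def)
    also have "\<dots> \<le> real_of_int (bit_length (l * D) n')" using that(3) by simp
    also have "\<dots> < real n' * L + 1"
      unfolding bit_length_def L_def by linarith
    finally have "real d\<^sub>0 * R / \<delta> * L < real n' * L" by linarith
    \<comment> \<open>The strict inequality excludes \<open>L = 0\<close>: over a one-letter
      alphabet the bit length never reaches \<open>n\<^sub>0\<close>.\<close>
    then have "real d\<^sub>0 * R / \<delta> < real n'"
      using L by (simp only: mult_less_cancel_right)
    then have "real d\<^sub>0 * R < real d * R"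
      using assms(3,4) by (simp add: n' d field_simps)
    then show ?thesis using assms(3) by simp
  qed
  show ?thesis
  proof (intro exI[of _ n\<^sub>0] allI impI, elim conjE)
    fix N n' d E A \<rho>
    assume code: "error_correcting_code (l * D) N n' d E"
      and ratios: "real n' / real N = R" "real d / real N = \<delta>" and bits: "n\<^sub>0 \<le> bit_length (l * D) n'"
      and A: "\<forall>i \<in> {1..r}. A i \<in> words (l * D) n'" "inj_on A {1..r}"
      and \<rho>: "density_operator (D ^ N) \<rho>"
    define K where "K i = accept_root D l \<psi> (E (A i))" for i
    have EA: "E (A i) \<in> words (l * D) N" if "i \<in> {1..r}" for i
      using code A(1) that unfolding error_correcting_code_def by blast
    then have len: "length (E (A i)) = N" and set: "set (E (A i)) \<subseteq> {..<l * D}" if "i \<in> {1..r}" for i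
      using that by (auto simp: words_def)
    have "(\<Sum>i = 1..r. Re (mat_trace (\<rho> * (K i * K i)))) \<le> 1 + (real (card {1..r}))\<^sup>2 * c ^ d"
    proof (rule density_operator_sum_squares_le[OF _ _ _ _ _ _ \<rho>])
      fix i assume i: "i \<in> {1..r}"
      show "K i \<in> carrier_mat (D ^ N) (D ^ N)"
        using accept_root_carrier[of D l \<psi> "E (A i)"] by (simp add: K_def len[OF i])
      show "op_bound (D ^ N) (K i) 1"
        using op_bound_accept_root[OF ps set[OF i]] by (simp add: K_def len[OF i])
      show "K i $$ (a, b) = cnj (K i $$ (b, a))" if "a < D ^ N" "b < D ^ N" for a b
        unfolding K_def using that by (intro accept_root_hermitian) (simp_all add: len[OF i])
      \<comment> \<open>Injectivity of \<open>A\<close> makes the two strings distinct, so the code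
        separates their codewords in at least \<open>d\<close> positions and the cross bound is
        \<open>c ^ d\<close>.\<close>
      fix j assume j: "j \<in> {1..r}" and "i \<noteq> j"
      then have "A i \<noteq> A j" using inj_onD[OF A(2) _ i j] by blast
      then have "d \<le> card {k. k < N \<and> E (A i) ! k \<noteq> E (A j) ! k}"
        using code A(1) i j unfolding error_correcting_code_def by blast
      then have "d \<le> card {k. k < length (E (A i)) \<and> E (A i) ! k \<noteq> E (A j) ! k}"
        by (simp only: len[OF i])
      then show "op_bound (D ^ N) (K i * K j) (c ^ d)"
        using op_bound_accept_root_mult[OF ps set[OF i] set[OF j] _ c gap] len[OF i] len[OF j]
        by (simp add: K_def)
    qed (use c in auto)
    also have "(\<Sum>i = 1..r. Re (mat_trace (\<rho> * (K i * K i)))) = (\<Sum>i = 1..r. accept_prob D l \<psi> \<rho> (E (A i)))"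
    proof (intro sum.cong refl)
      fix i assume i: "i \<in> {1..r}"
      have "\<rho> \<in> carrier_mat (D ^ N) (D ^ N)" using \<rho> by (simp add: density_operator_def)
      then show "Re (mat_trace (\<rho> * (K i * K i))) = accept_prob D l \<psi> \<rho> (E (A i))"
        using accept_prob_eq_trace[OF ps EA[OF i]] accept_root_square[OF ps set[OF i]]
        by (simp add: K_def)
    qed
    also have "1 + (real (card {1..r}))\<^sup>2 * c ^ d \<le> 1 + (real r)\<^sup>2 * c ^ d\<^sub>0"
      using large[OF ratios bits] c by (simp add: mult_left_mono power_decreasing)
    also have "\<dots> \<le> 1 + \<epsilon>" using d\<^sub>0 by simp
    finally show "(\<Sum>i = 1..r. accept_prob D l \<psi> \<rho> (E (A i))) \<le> 1 + \<epsilon>" .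
  qed
qed

end
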